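(* Let $\alpha,\bar\alpha\in\mathbb{C}$ and $\Delta,\bar\Delta\in\mathbb{C}^*$. Nontrivial extensions of conformal $\mathcal{R}$-modules of the form $$0\longrightarrow V(\bar\alpha,\bar\Delta)\longrightarrow E\longrightarrow V(\alpha,\Delta)\longrightarrow 0$$ exist only if $\alpha=\bar\alpha$ and $\Delta-\bar\Delta\in\{0,1,2,3,4,5,6\}$. Every such nontrivial extension is given, up to equivalence, by $E=\mathbb{C}[\partial]v_{\bar\Delta}\oplus\mathbb{C}[\partial]v_\Delta$ (direct sum of $\mathbb{C}[\partial]$-modules, with $\mathbb{C}[\partial]v_{\bar\Delta}=V(\bar\alpha,\bar\Delta)$ an $\mathcal{R}$-submodule) with $$L_\lambda v_\Delta=(\partial+\alpha+\Delta\lambda)v_\Delta+f(\partial,\lambda)v_{\bar\Delta},\qquad I_\lambda v_\Delta=g(\partial,\lambda)v_{\bar\Delta}.$$ With $\bar\partial=\partial+\alpha$, the following is a complete list of the values of $\Delta$ and $\bar\Delta$, along with the pairs of polynomials $f(\partial,\lambda)$ and $g(\partial,\lambda)$, giving rise to nontrivial extensions: (i) $\Delta=\bar\Delta$, $g(\partial,\lambda)=0$, $f(\partial,\lambda)=c_0+c_1\lambda$, $(c_0,c_1)\neq(0,0)$. (ii) $\Delta-\bar\Delta=1$, $g(\partial,\lambda)=a_1\lambda$, $f(\partial,\lambda)=\frac{a_1}{\bar\Delta}\bar\partial$, $a_1\neq 0$. (iii) $\Delta-\bar\Delta=2$, $g(\partial,\lambda)=0$, $f(\partial,\lambda)=b_1\lambda^2(2\bar\partial+\lambda)$,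 $b_1\neq 0$. (iii') $\Delta=1$, $\bar\Delta=-1$, $g(\partial,\lambda)=a_1(\bar\partial+\lambda)\lambda$, $f(\partial,\lambda)=a_1(\lambda^2-\bar\partial^2)+b(2\bar\partial+\lambda)\lambda^2$, $a_1\neq 0$, $b\in\mathbb{C}$. (iv) $\Delta-\bar\Delta=3$, $g(\partial,\lambda)=0$, $f(\partial,\lambda)=b_1\bar\partial\lambda^2(\bar\partial+\lambda)$, $b_1\neq 0$. (v) $\Delta-\bar\Delta=4$, $g(\partial,\lambda)=0$, $f(\partial,\lambda)=b_1\lambda^2(4\bar\partial^3+6\bar\partial^2\lambda-\bar\partial\lambda^2+\bar\Delta\lambda^3)$, $b_1\neq 0$. (vi) $(\Delta,\bar\Delta)=(1,-4)$, $g(\partial,\lambda)=0$, $f(\partial,\lambda)=b_1\big(\bar\partial^4\lambda^2-10\bar\partial^2\lambda^4-17\bar\partial\lambda^5-8\lambda^6\big)$, $b_1\neq 0$. (vii) $(\Delta,\bar\Delta)=\big(\tfrac72\pm\tfrac{\sqrt{19}}2,\,-\tfrac52\pm\tfrac{\sqrt{19}}2\big)$ (same choice of sign in both entries), $g(\partial,\lambda)=0$, $f(\partial,\lambda)=b_1\big(\bar\partial^4\lambda^3-(2\bar\Delta+3)\bar\partial^3\lambda^4-3\bar\Delta\bar\partial^2\lambda^5-(3\bar\Delta+1)\bar\partial\lambda^6-(\bar\Delta+\tfrac9{28})\lambda^7\big)$, $b_1\neq 0$.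
   Context: $\mathcal{R}=\mathbb{C}[\partial]L\oplus\mathbb{C}[\partial]I$ is the Lie conformal algebra, free of rank $2$ over $\mathbb{C}[\partial]$, with $[L_\lambda L]=(\partial+2\lambda)(L+I)$, $[L_\lambda I]=(\partial+\lambda)I$, $[I_\lambda L]=\lambda I$, $[I_\lambda I]=0$. A conformal module $V$ over $\mathcal{R}$ is a $\mathbb{C}[\partial]$-module with a $\mathbb{C}$-linear map $\mathcal{R}\to \mathrm{End}_{\mathbb{C}}(V)\otimes\mathbb{C}[\lambda]$, $a\mapsto a_\lambda$, such that $a_\lambda b_\mu-b_\mu a_\lambda=[a_\lambda b]_{\lambda+\mu}$ and $(\partial a)_\lambda=[\partial,a_\lambda]=-\lambda a_\lambda$ (so $a_\lambda(\partial v)=(\partial+\lambda)a_\lambda v$). $V(\alpha,\Delta)=\mathbb{C}[\partial]v_\Delta$ is the module free of rank one over $\mathbb{C}[\partial]$ with $L_\lambda v_\Delta=(\partial+\alpha+\Delta\lambda)v_\Delta$, $I_\lambda v_\Delta=0$; likewise $V(\bar\alpha,\bar\Delta)=\mathbb{C}[\partial]v_{\bar\Delta}$ with parameters $\bar\alpha,\bar\Delta$ (bars do not denote complex conjugation). An extension of $W$ by $V$ is an exact sequence of $\mathcal{R}$-modules $0\to V\to E\to W\to 0$. Two extensions $E,E'$ of $W$ by $V$ are equivalent if there is a module homomorphism $\psi:E\to E'$ compatible with the identity maps of $V$ and $W$. An extension is trivial if it is equivalent to the direct sum $V\oplus W$, and nontrivial otherwise. *)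

theory Defs
  imports Complex_Main "HOL-Library.Product_Plus" "HOL-Computational_Algebra.Polynomial"
begin

text \<open>
  The ring \<open>\<complex>[\<partial>]\<close> is \<^typ>\<open>complex poly\<close>, and a \<open>\<complex>[\<partial>]\<close>-module is an instance of
  the library locale \<^locale>\<open>module\<close>; its underlying complex vector space has the scalar
  multiplication by constant polynomials.

  A polynomial in \<open>\<lambda>\<close> with coefficients in a complex vector space is represented by its values
  at the complex numbers, that is, by a function of \<open>\<lambda>\<close> that is required to be polynomial.
  Since \<open>\<complex>\<close> is infinite, such functions (also in several variables) correspond bijectively
  to formal polynomials.
\<close>

abbreviation Dpoly :: "complex poly" where
  "Dpoly \<equiv> [:0, 1:]"

(* p(D) |-> p(D + lam) *)
definition pshift :: "complex \<Rightarrow> complex poly \<Rightarrow> complex poly" where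
  "pshift lam p = pcompose p [:lam, 1:]"

(* p(D) |-> p(-lam), a constant *)
definition pneg :: "complex \<Rightarrow> complex poly \<Rightarrow> complex poly" where
  "pneg lam p = [:poly p (- lam):]"

section \<open>The Lie conformal algebra\<close>

text \<open>The pair \<open>(p, r)\<close> stands for \<open>p(\<partial>) L + r(\<partial>) I\<close>.\<close>

type_synonym lca = "complex poly \<times> complex poly"

definition lca_scale :: "complex poly \<Rightarrow> lca \<Rightarrow> lca" where
  "lca_scale q a = (q * fst a, q * snd a)"

definition genL :: lca where "genL = (1, 0)"

definition genI :: lca where "genI = (0, 1)"

text \<open>
  \<open>lca_bracket a lam b\<close> is \<open>[a\<^sub>\<lambda> b]\<close>. It extends the brackets of the generators by
  sesquilinearity, \<open>[(p(\<partial>)a)\<^sub>\<lambda> (q(\<partial>)b)] = p(-\<lambda>) q(\<partial>+\<lambda>) [a\<^sub>\<lambda> b]\<close>; the summand for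
  \<open>[I\<^sub>\<lambda> I] = 0\<close> is omitted.
\<close>

definition lca_bracket :: "lca \<Rightarrow> complex \<Rightarrow> lca \<Rightarrow> lca" where
  "lca_bracket a lam b =
     lca_scale (pneg lam (fst a) * pshift lam (fst b)) (lca_scale [:2 * lam, 1:] (genL + genI))
   + lca_scale (pneg lam (fst a) * pshift lam (snd b)) (lca_scale [:lam, 1:] genI)
   + lca_scale (pneg lam (snd a) * pshift lam (fst b)) (lca_scale [:lam:] genI)"

section \<open>Conformal modules\<close>

text \<open>
  \<open>act M a lam v\<close> is \<open>a\<^sub>\<lambda> v\<close>. As usual for conformal modules, \<open>a\<^sub>\<lambda> v\<close> is polynomial
  in \<open>\<lambda>\<close> for each \<open>v\<close>; the degree may depend on \<open>v\<close>, as it does in every nonzero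
  \<open>V(\<alpha>,\<Delta>)\<close>, where \<open>L\<^sub>\<lambda> (\<partial>\<^sup>k v) = (\<partial>+\<lambda>)\<^sup>k L\<^sub>\<lambda> v\<close>.
\<close>

record 'e cmod =
  scl :: "complex poly \<Rightarrow> 'e \<Rightarrow> 'e"
  act :: "lca \<Rightarrow> complex \<Rightarrow> 'e \<Rightarrow> 'e"

definition polynomial_family :: "(complex poly \<Rightarrow> 'e \<Rightarrow> 'e) \<Rightarrow> (complex \<Rightarrow> 'e::ab_group_add) \<Rightarrow> bool" where
  "polynomial_family s h \<longleftrightarrow>
     (\<exists>(N::nat) (c::nat \<Rightarrow> 'e). \<forall>lam. h lam = (\<Sum>n\<le>N. s [:lam ^ n:] (c n)))"

definition conformal_module :: "'e::ab_group_add cmod \<Rightarrow> bool" where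
  "conformal_module M \<longleftrightarrow>
     module (scl M)
   \<and> (\<forall>a lam v w. act M a lam (v + w) = act M a lam v + act M a lam w)
   \<and> (\<forall>a lam c v. act M a lam (scl M [:c:] v) = scl M [:c:] (act M a lam v))
   \<and> (\<forall>a v. polynomial_family (scl M) (\<lambda>lam. act M a lam v))
   \<and> (\<forall>a b lam v. act M (a + b) lam v = act M a lam v + act M b lam v)
   \<and> (\<forall>c a lam v. act M (lca_scale [:c:] a) lam v = scl M [:c:] (act M a lam v))
   \<and> (\<forall>a b lam mu v. act M a lam (act M b mu v) - act M b mu (act M a lam v)
                       = act M (lca_bracket a lam b) (lam + mu) v)
   \<and> (\<forall>a lam v. act M (lca_scale Dpoly a) lam v
                       = scl M Dpoly (act M a lam v) - act M a lam (scl M Dpoly v))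
   \<and> (\<forall>a lam v. act M (lca_scale Dpoly a) lam v = - scl M [:lam:] (act M a lam v))"

definition cmod_hom :: "'v::ab_group_add cmod \<Rightarrow> 'w::ab_group_add cmod \<Rightarrow> ('v \<Rightarrow> 'w) \<Rightarrow> bool" where
  "cmod_hom M N \<psi> \<longleftrightarrow>
     module_hom (scl M) (scl N) \<psi> \<and> (\<forall>a lam v. \<psi> (act M a lam v) = act N a lam (\<psi> v))"

definition cmod_sum :: "'v cmod \<Rightarrow> 'w cmod \<Rightarrow> ('v \<times> 'w) cmod" where
  "cmod_sum M N =
     \<lparr> scl = (\<lambda>p x. (scl M p (fst x), scl N p (snd x))),
       act = (\<lambda>a lam x. (act M a lam (fst x), act N a lam (snd x))) \<rparr>"

text \<open>
  The module \<open>V(\<alpha>,\<Delta>)\<close>, where \<open>q\<close> stands for \<open>q(\<partial>) v\<^sub>\<Delta>\<close>.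
\<close>

definition Vmod :: "complex \<Rightarrow> complex \<Rightarrow> complex poly cmod" where
  "Vmod \<alpha> \<Delta> =
     \<lparr> scl = (*),
       act = (\<lambda>a lam q. pneg lam (fst a) * pshift lam q * [:\<alpha> + \<Delta> * lam, 1:]) \<rparr>"

section \<open>Extensions\<close>

text \<open>
  An extension of \<open>W\<close> by \<open>V\<close> is a module \<open>E\<close> with homomorphisms \<open>\<iota> : V \<rightarrow> E\<close> and
  \<open>\<pi> : E \<rightarrow> W\<close> that form a short exact sequence.
\<close>

definition is_extension ::
  "'v::ab_group_add cmod \<Rightarrow> 'w::ab_group_add cmod \<Rightarrow>
   'e::ab_group_add cmod \<Rightarrow> ('v \<Rightarrow> 'e) \<Rightarrow> ('e \<Rightarrow> 'w) \<Rightarrow> bool" where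
  "is_extension V W E \<iota> \<pi> \<longleftrightarrow>
     conformal_module V \<and> conformal_module W \<and> conformal_module E
   \<and> cmod_hom V E \<iota> \<and> cmod_hom E W \<pi>
   \<and> inj \<iota> \<and> range \<iota> = {x. \<pi> x = 0} \<and> surj \<pi>"

definition equivalent_ext ::
  "'e::ab_group_add cmod \<Rightarrow> ('v \<Rightarrow> 'e) \<Rightarrow> ('e \<Rightarrow> 'w) \<Rightarrow>
   'f::ab_group_add cmod \<Rightarrow> ('v \<Rightarrow> 'f) \<Rightarrow> ('f \<Rightarrow> 'w) \<Rightarrow> bool" where
  "equivalent_ext E \<iota> \<pi> E' \<iota>' \<pi>' \<longleftrightarrow>
     (\<exists>\<psi>. cmod_hom E E' \<psi> \<and> \<psi> \<circ> \<iota> = \<iota>' \<and> \<pi>' \<circ> \<psi> = \<pi>)"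

definition trivial_extension ::
  "'v::ab_group_add cmod \<Rightarrow> 'w::ab_group_add cmod \<Rightarrow>
   'e::ab_group_add cmod \<Rightarrow> ('v \<Rightarrow> 'e) \<Rightarrow> ('e \<Rightarrow> 'w) \<Rightarrow> bool" where
  "trivial_extension V W E \<iota> \<pi> \<longleftrightarrow>
     is_extension V W E \<iota> \<pi> \<and> equivalent_ext E \<iota> \<pi> (cmod_sum V W) (\<lambda>v. (v, 0)) snd"

definition nontrivial_extension ::
  "'v::ab_group_add cmod \<Rightarrow> 'w::ab_group_add cmod \<Rightarrow>
   'e::ab_group_add cmod \<Rightarrow> ('v \<Rightarrow> 'e) \<Rightarrow> ('e \<Rightarrow> 'w) \<Rightarrow> bool" where
  "nontrivial_extension V W E \<iota> \<pi> \<longleftrightarrow>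
     is_extension V W E \<iota> \<pi> \<and> \<not> trivial_extension V W E \<iota> \<pi>"

section \<open>Extensions given by a pair of polynomials\<close>

text \<open>
  A polynomial \<open>f(\<partial>,\<lambda>)\<close> is an element of \<open>\<complex>[\<partial>][\<lambda>]\<close>, so \<open>\<lambda>\<close> is the outer variable.
\<close>

abbreviation cst :: "complex \<Rightarrow> complex poly poly" where
  "cst c \<equiv> [:[:c:]:]"

abbreviation Lam :: "complex poly poly" where
  "Lam \<equiv> [:0, 1:]"

abbreviation Dbar :: "complex \<Rightarrow> complex poly poly" where
  "Dbar \<alpha> \<equiv> [:[:\<alpha>, 1:]:]"

definition at_lam :: "complex poly poly \<Rightarrow> complex \<Rightarrow> complex poly" where
  "at_lam f lam = poly f [:lam:]"

text \<open>
  The barred parameters and generator of the submodule are written with a prime. The pair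
  \<open>(q', q)\<close> stands for \<open>q'(\<partial>) v\<^sub>\<Delta>\<^sub>' + q(\<partial>) v\<^sub>\<Delta>\<close>, and the action is determined by
  \<open>L\<^sub>\<lambda> v\<^sub>\<Delta> = (\<partial> + \<alpha> + \<Delta>\<lambda>) v\<^sub>\<Delta> + f(\<partial>,\<lambda>) v\<^sub>\<Delta>\<^sub>'\<close>, \<open>I\<^sub>\<lambda> v\<^sub>\<Delta> = g(\<partial>,\<lambda>) v\<^sub>\<Delta>\<^sub>'\<close>
  and the action on \<open>V(\<alpha>',\<Delta>')\<close>.
\<close>

definition Emod ::
  "complex \<Rightarrow> complex \<Rightarrow> complex \<Rightarrow> complex \<Rightarrow> complex poly poly \<Rightarrow> complex poly poly \<Rightarrow>
   (complex poly \<times> complex poly) cmod" where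
  "Emod \<alpha>' \<Delta>' \<alpha> \<Delta> f g =
     \<lparr> scl = (\<lambda>p x. (p * fst x, p * snd x)),
       act = (\<lambda>a lam x.
         (act (Vmod \<alpha>' \<Delta>') a lam (fst x)
            + pshift lam (snd x)
                * (pneg lam (fst a) * at_lam f lam + pneg lam (snd a) * at_lam g lam),
          act (Vmod \<alpha> \<Delta>) a lam (snd x))) \<rparr>"

inductive listed :: "complex \<Rightarrow> complex \<Rightarrow> complex \<Rightarrow> complex poly poly \<Rightarrow> complex poly poly \<Rightarrow> bool"
  for \<alpha> \<Delta>' \<Delta> :: complex and f g :: "complex poly poly"
where
  i: "\<lbrakk> \<Delta> = \<Delta>'; g = 0; f = cst c0 + cst c1 * Lam; (c0, c1) \<noteq> (0, 0) \<rbrakk>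
      \<Longrightarrow> listed \<alpha> \<Delta>' \<Delta> f g"
| ii: "\<lbrakk> \<Delta> - \<Delta>' = 1; g = cst a1 * Lam; f = cst (a1 / \<Delta>') * Dbar \<alpha>; a1 \<noteq> 0 \<rbrakk>
      \<Longrightarrow> listed \<alpha> \<Delta>' \<Delta> f g"
| iii: "\<lbrakk> \<Delta> - \<Delta>' = 2; g = 0; f = cst b1 * Lam\<^sup>2 * (2 * Dbar \<alpha> + Lam); b1 \<noteq> 0 \<rbrakk>
      \<Longrightarrow> listed \<alpha> \<Delta>' \<Delta> f g"
| iii': "\<lbrakk> \<Delta> = 1; \<Delta>' = -1; g = cst a1 * (Dbar \<alpha> + Lam) * Lam;
          f = cst a1 * (Lam\<^sup>2 - (Dbar \<alpha>)\<^sup>2) + cst b * (2 * Dbar \<alpha> + Lam) * Lam\<^sup>2; a1 \<noteq> 0 \<rbrakk>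
      \<Longrightarrow> listed \<alpha> \<Delta>' \<Delta> f g"
| iv: "\<lbrakk> \<Delta> - \<Delta>' = 3; g = 0; f = cst b1 * Dbar \<alpha> * Lam\<^sup>2 * (Dbar \<alpha> + Lam); b1 \<noteq> 0 \<rbrakk>
      \<Longrightarrow> listed \<alpha> \<Delta>' \<Delta> f g"
| v: "\<lbrakk> \<Delta> - \<Delta>' = 4; g = 0;
        f = cst b1 * Lam\<^sup>2 * (4 * (Dbar \<alpha>)^3 + 6 * (Dbar \<alpha>)\<^sup>2 * Lam
              - Dbar \<alpha> * Lam\<^sup>2 + cst \<Delta>' * Lam^3); b1 \<noteq> 0 \<rbrakk>
      \<Longrightarrow> listed \<alpha> \<Delta>' \<Delta> f g"
| vi: "\<lbrakk> \<Delta> = 1; \<Delta>' = -4; g = 0;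
        f = cst b1 * ((Dbar \<alpha>)^4 * Lam\<^sup>2 - 10 * (Dbar \<alpha>)\<^sup>2 * Lam^4
              - 17 * Dbar \<alpha> * Lam^5 - 8 * Lam^6); b1 \<noteq> 0 \<rbrakk>
      \<Longrightarrow> listed \<alpha> \<Delta>' \<Delta> f g"
| vii: "\<lbrakk> (\<Delta> = 7/2 + of_real (sqrt 19) / 2 \<and> \<Delta>' = - 5/2 + of_real (sqrt 19) / 2)
          \<or> (\<Delta> = 7/2 - of_real (sqrt 19) / 2 \<and> \<Delta>' = - 5/2 - of_real (sqrt 19) / 2);
        g = 0;
        f = cst b1 * ((Dbar \<alpha>)^4 * Lam^3 - cst (2 * \<Delta>' + 3) * (Dbar \<alpha>)^3 * Lam^4
              - cst (3 * \<Delta>') * (Dbar \<alpha>)\<^sup>2 * Lam^5 - cst (3 * \<Delta>' + 1) * Dbar \<alpha> * Lam^6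
              - cst (\<Delta>' + 9/28) * Lam^7); b1 \<noteq> 0 \<rbrakk>
      \<Longrightarrow> listed \<alpha> \<Delta>' \<Delta> f g"

section \<open>Basic properties\<close>

lemma lca_bracket_generators:
  "lca_bracket genL lam genL = lca_scale [:2 * lam, 1:] (genL + genI)"
  "lca_bracket genL lam genI = lca_scale [:lam, 1:] genI"
  "lca_bracket genI lam genL = lca_scale [:lam:] genI"
  "lca_bracket genI lam genI = 0"
  by (simp_all add: lca_bracket_def genL_def genI_def lca_scale_def pneg_def pshift_def
      pcompose_1 zero_prod_def one_pCons)

lemma Vmod_generators:
  "act (Vmod \<alpha> \<Delta>) genL lam 1 = [:\<alpha> + \<Delta> * lam, 1:]"
  "act (Vmod \<alpha> \<Delta>) genI lam 1 = 0"
  by (simp_all add: Vmod_def genL_def genI_def pneg_def pshift_def pcompose_1)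

lemma Emod_generators:
  "act (Emod \<alpha>' \<Delta>' \<alpha> \<Delta> f g) genL lam (0, 1) = (at_lam f lam, [:\<alpha> + \<Delta> * lam, 1:])"
  "act (Emod \<alpha>' \<Delta>' \<alpha> \<Delta> f g) genI lam (0, 1) = (at_lam g lam, 0)"
  "act (Emod \<alpha>' \<Delta>' \<alpha> \<Delta> f g) a lam (q, 0) = (act (Vmod \<alpha>' \<Delta>') a lam q, 0)"
  by (simp_all add: Emod_def Vmod_def genL_def genI_def pneg_def pshift_def pcompose_1)

lemma poly_pshift [simp]: "poly (pshift lam p) x = poly p (x + lam)"
  by (simp add: pshift_def poly_pcompose add.commute)

lemma poly_pneg [simp]: "poly (pneg lam p) x = poly p (- lam)"
  by (simp add: pneg_def)

lemma poly_at_lam: "poly (at_lam f lam) x = (\<Sum>n\<le>degree f. poly (coeff f n) x * lam ^ n)"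
  by (simp add: at_lam_def poly_altdef [of f] poly_sum)

lemma polynomial_family_at_lam: "polynomial_family (*) (\<lambda>lam. at_lam f lam)"
  unfolding polynomial_family_def
proof (intro exI allI)
  fix lam
  show "at_lam f lam = (\<Sum>n\<le>degree f. [:lam ^ n:] * coeff f n)"
    by (simp add: at_lam_def poly_altdef [of f] poly_const_pow mult.commute)
qed

lemma pneg_at_lam: "\<exists>f. \<forall>lam. pneg lam p = at_lam f lam"
proof (induction p)
  case 0
  show ?case by (rule exI [of _ 0]) (simp add: pneg_def at_lam_def)
next
  case (pCons c p)
  then obtain f where f: "\<And>lam. pneg lam p = at_lam f lam" by auto
  have "pneg lam (pCons c p) = at_lam ([:[:c:]:] + [:0, -1:] * f) lam" for lam
    using f [of lam, symmetric] by (simp add: at_lam_def pneg_def)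
  then show ?case by blast
qed

lemma pshift_at_lam: "\<exists>f. \<forall>lam. pshift lam q = at_lam f lam"
proof (induction q)
  case 0
  show ?case by (rule exI [of _ 0]) (simp add: pshift_def at_lam_def)
next
  case (pCons c q)
  then obtain f where f: "\<And>lam. pshift lam q = at_lam f lam" by auto
  show ?case
    by (rule exI [of _ "[:[:c:]:] + [:Dpoly, 1:] * f"])
       (use f in \<open>auto simp: pshift_def at_lam_def pcompose_pCons algebra_simps\<close>)
qed

lemma conformal_module_Vmod: "conformal_module (Vmod \<alpha> \<Delta>)"
proof -
  have "polynomial_family (*) (\<lambda>lam. pneg lam p * pshift lam q * [:\<alpha> + \<Delta> * lam, 1:])" for p q
  proof -
    obtain f g where "\<And>lam. pneg lam p = at_lam f lam" "\<And>lam. pshift lam q = at_lam g lam"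
      using pneg_at_lam pshift_at_lam by metis
    then have "(\<lambda>lam. pneg lam p * pshift lam q * [:\<alpha> + \<Delta> * lam, 1:])
        = (\<lambda>lam. at_lam (f * g * [:[:\<alpha>, 1:], [:\<Delta>:]:]) lam)"
      by (auto simp: at_lam_def fun_eq_iff smult_add_left)
    then show ?thesis by (simp only: polynomial_family_at_lam)
  qed
  moreover have "module ((*) :: complex poly \<Rightarrow> _)"
    by unfold_locales (simp_all add: algebra_simps)
  ultimately show ?thesis
    by (simp add: conformal_module_def Vmod_def)
       (simp add: poly_eq_poly_eq_iff [symmetric] fun_eq_iff lca_bracket_def lca_scale_def
          genL_def genI_def algebra_simps)
qed

end

theory Submission
  imports Defs
begin

text \<open>
  Fix an extension \<open>E\<close> and a preimage \<open>v\<close> of the generator of \<open>V(\<alpha>,\<Delta>)\<close>. The action of \<open>L\<close> and \<open>I\<close>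
  on \<open>v\<close> is recorded by two polynomials \<open>f\<close> and \<open>g\<close>, and \<open>E\<close> is equivalent to the module built from
  them (lemma \<open>generator_equivalent\<close>). The axioms for \<open>[L\<^sub>\<lambda> L]\<close> and \<open>[L\<^sub>\<lambda> I]\<close> on \<open>v\<close> say that \<open>(f,g)\<close>
  satisfies two functional equations, the cocycle equations, and replacing \<open>v\<close> by \<open>v + \<phi>(\<partial>)v'\<close>
  changes \<open>f\<close> by the coboundary of \<open>\<phi>\<close> and leaves \<open>g\<close> alone. So the theorem is a computation of
  cocycles modulo coboundaries.

  If \<open>\<alpha>\<close> and \<open>\<alpha>'\<close> differ, the equations at \<open>\<lambda> = 0\<close> and at \<open>\<mu> = 0\<close> show that \<open>g = 0\<close> and that \<open>f\<close> is a
  coboundary. If \<open>\<alpha> = \<alpha>'\<close>, the equations are homogeneous in \<open>y = \<partial>+\<alpha>\<close>, \<open>\<lambda>\<close>, \<open>\<mu>\<close>, and the homogeneous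
  parts of a cocycle can be treated one by one. Let \<open>n\<close> be the degree and \<open>\<delta> = \<Delta>-\<Delta>'\<close>. The
  coefficients of \<open>\<mu>\<close> in the equation for \<open>f\<close> express \<open>(\<delta>+1-n)f\<close> by a coboundary and by \<open>g\<close>, and those
  of \<open>\<mu>\<^sup>0\<close> express \<open>g\<close> by \<open>f(y,0)\<close>; the equation for \<open>g\<close> then admits \<open>f(y,0) \<noteq> 0\<close> only for
  \<open>n = \<delta> \<le> 2\<close>. Hence only \<open>n = \<delta>\<close> and \<open>n = \<delta>+1\<close> matter. The degree \<open>n = \<delta>\<close> gives the constants
  in \<open>listed.i\<close>, the pairs \<open>listed.ii\<close>, and the part of \<open>listed.iii'\<close> with coefficient \<open>a\<^sub>1\<close>.

  In the critical degree \<open>n = \<delta>+1\<close> one has \<open>g = 0\<close>, and for \<open>n \<ge> 2\<close> also \<open>f = \<Sum>\<^sub>i a\<^sub>i y\<^sup>n\<^sup>-\<^sup>i\<lambda>\<^sup>i\<close> with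
  \<open>i \<ge> 2\<close>. The coefficients of \<open>\<lambda>\<^sup>2\<mu>\<^sup>j\<close> form a recursion that computes \<open>a\<^sub>4, a\<^sub>5, \<dots>\<close> from \<open>a\<^sub>2\<close> and \<open>a\<^sub>3\<close>;
  it mirrors the fact that the vector fields \<open>L\<^sub>1, L\<^sub>2\<close> generate all \<open>L\<^sub>k\<close> with \<open>k \<ge> 1\<close>. So a cocycle is
  known once \<open>(a\<^sub>2,a\<^sub>3)\<close> is known, and the coboundary of \<open>y\<^sup>n\<^sup>-\<^sup>1\<close> occupies one direction of this plane.
  For \<open>n \<ge> 6\<close> the coefficient of \<open>\<lambda>\<^sup>3\<mu>\<^sup>4\<close> computes \<open>a\<^sub>6\<close> a second time. The discrepancy vanishes on
  coboundaries, so it is the determinant of \<open>(a\<^sub>2,a\<^sub>3)\<close> against the coboundary, times a polynomial in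
  \<open>n\<close> and \<open>\<Delta>'\<close>; with \<open>w = \<Delta>'+(n-2)/2\<close> that polynomial is a multiple of \<open>w\<^sup>2-(3n-2)/4\<close>
  (lemma \<open>weight_five_relation\<close>). Its roots are \<open>\<Delta>' = -4\<close> and the excluded
  value \<open>0\<close> for \<open>n = 6\<close>, and \<open>\<Delta>' = (-5 \<plusminus> \<surd>19)/2\<close> for \<open>n = 7\<close>, which are the cases \<open>listed.vi\<close> and
  \<open>listed.vii\<close>. For \<open>n \<ge> 8\<close> the coefficient of \<open>\<lambda>\<^sup>3\<mu>\<^sup>6\<close> gives a second condition (lemma
  \<open>weight_seven_relation\<close>). Under the first one it reads \<open>(n-1)(n-2)\<dots>(n-7) = 0\<close>, unless the
  determinant is zero. Therefore nothing survives beyond \<open>\<delta> = 6\<close>.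

  Conversely, the listed pairs are cocycles by expansion. They are not coboundaries, because
  \<open>g \<noteq> 0\<close>, or by inspection in the case \<open>listed.i\<close>, or because \<open>(a\<^sub>2,a\<^sub>3)\<close> is not proportional to that of the
  coboundary of \<open>y\<^sup>n\<^sup>-\<^sup>1\<close> (lemma \<open>critical_cochain_det\<close>).
\<close>

section \<open>Cocycles and coboundaries\<close>

text \<open>
  The cocycle equations are used for functions rather than formal polynomials: \<open>F y l\<close> is the value
  of \<open>f\<close> at \<open>\<partial>+\<alpha> = y\<close> and \<open>\<lambda> = l\<close>. A defect is the difference of the two sides of the axiom for
  \<open>[L\<^sub>\<lambda> L]\<close>, respectively \<open>[L\<^sub>\<lambda> I]\<close>, with \<open>m\<close> the value of \<open>\<mu>\<close>. Below, \<open>x\<close> mostly stands for \<open>\<Delta>'\<close>,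
  \<open>a\<close> for the coefficients of \<open>F\<close>, and \<open>b\<close> for those of \<open>G\<close>.
\<close>

definition LL_defect ::
  "complex \<Rightarrow> complex \<Rightarrow> (complex \<Rightarrow> complex \<Rightarrow> complex) \<Rightarrow> (complex \<Rightarrow> complex \<Rightarrow> complex) \<Rightarrow>
   complex \<Rightarrow> complex \<Rightarrow> complex \<Rightarrow> complex" where
  "LL_defect \<Delta>' \<Delta> F G y l m =
     (y + l + \<Delta> * m) * F y l + (y + \<Delta>' * l) * F (y + l) m
     - (y + m + \<Delta> * l) * F y m - (y + \<Delta>' * m) * F (y + m) l
     - (l - m) * (F y (l + m) + G y (l + m))"

definition LI_defect ::
  "complex \<Rightarrow> complex \<Rightarrow> (complex \<Rightarrow> complex \<Rightarrow> complex) \<Rightarrow>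
   complex \<Rightarrow> complex \<Rightarrow> complex \<Rightarrow> complex" where
  "LI_defect \<Delta>' \<Delta> G y l m =
     (y + \<Delta>' * l) * G (y + l) m - (y + m + \<Delta> * l) * G y m + m * G y (l + m)"

text \<open>
  The change of \<open>f\<close> when \<open>\<phi>(\<partial>)v'\<close> is added to the chosen generator.
\<close>

definition coboundary :: "complex \<Rightarrow> complex \<Rightarrow> (complex \<Rightarrow> complex) \<Rightarrow> complex \<Rightarrow> complex \<Rightarrow> complex" where
  "coboundary \<Delta>' \<Delta> \<phi> y l = (y + \<Delta>' * l) * \<phi> (y + l) - (y + \<Delta> * l) * \<phi> y"

lemma LL_defect_coboundary: "LL_defect \<Delta>' \<Delta> (coboundary \<Delta>' \<Delta> \<phi>) (\<lambda>_ _. 0) y l m = 0"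
  by (simp add: LL_defect_def coboundary_def algebra_simps)

text \<open>
  A homogeneous polynomial of degree \<open>n\<close> in \<open>y\<close> and \<open>l\<close>. Nothing is lost by setting \<open>y = 1\<close>, which
  turns the cocycle equations into identities in \<open>l\<close> and \<open>m\<close> only.
\<close>

definition hform :: "nat \<Rightarrow> (nat \<Rightarrow> complex) \<Rightarrow> complex \<Rightarrow> complex \<Rightarrow> complex" where
  "hform n a y l = (\<Sum>i\<le>n. a i * y ^ (n - i) * l ^ i)"

abbreviation bicoeff :: "complex poly poly \<Rightarrow> nat \<Rightarrow> nat \<Rightarrow> complex" where
  "bicoeff P i j \<equiv> coeff (coeff P j) i"

section \<open>Coefficients of homogeneous cocycles\<close>

lemma bipoly_eq_0:
  fixes P :: "complex poly poly"
  assumes "\<And>l m. poly (poly P [:m:]) l = 0"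
  shows "P = 0"
proof (rule ccontr)
  assume "P \<noteq> 0"
  then have fin: "finite {q. poly P q = 0}" by (rule poly_roots_finite)
  have "poly P [:m:] = 0" for m
    using assms by (auto simp: poly_eq_poly_eq_iff [symmetric] fun_eq_iff)
  then have "range (\<lambda>m. [:m:]) \<subseteq> {q. poly P q = 0}" by auto
  then have "finite (range (\<lambda>m::complex. [:m:]))" using fin by (rule finite_subset)
  then have "finite (UNIV :: complex set)" by (rule finite_imageD) (auto simp: inj_on_def)
  then show False using infinite_UNIV_char_0 by blast
qed

text \<open>
  The coefficient of \<open>l\<^sup>i\<^sup>+\<^sup>1\<close> in \<open>(1 + xl)(1 + l)\<^sup>k\<close>. It enters through the terms \<open>(y + \<Delta>'l) F (y + l) m\<close>
  of the defects, at \<open>y = 1\<close>.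
\<close>

definition shift_coeff :: "complex \<Rightarrow> nat \<Rightarrow> nat \<Rightarrow> complex" where
  "shift_coeff x k i = of_nat (k choose Suc i) + x * of_nat (k choose i)"

lemma coeff_1_1_power: "coeff ([:1, 1:] ^ k :: 'a::comm_semiring_1 poly) i = of_nat (k choose i)"
  by (cases "i \<le> k") (simp_all add: coeff_linear_poly_power binomial_eq_0 coeff_eq_0 le_less_trans [OF degree_power_le])

lemma coeff_shift_poly: "coeff ([:1, [:x:]:] * [:1, 1:] ^ k) (Suc i) = [:shift_coeff x k i:]"
  by (simp add: shift_coeff_def coeff_1_1_power of_nat_poly)

text \<open>
  The coefficients of \<open>l\<^sup>i\<^sup>+\<^sup>1\<close> and of \<open>l\<^sup>i\<^sup>+\<^sup>1m\<^sup>j\<^sup>+\<^sup>1\<close>. Pure powers of \<open>m\<close> repeat the first kind, since the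
  defect is antisymmetric in \<open>l\<close> and \<open>m\<close>.
\<close>

lemma LL_coeffs:
  assumes a0: "\<And>i. n < i \<Longrightarrow> a i = 0" and b0: "\<And>i. n < i \<Longrightarrow> b i = 0"
    and LL: "\<And>l m. LL_defect x \<Delta> (hform n a) (hform n b) 1 l m = 0"
  shows LL_coeff_0: "b i = a 0 * (shift_coeff x n i - (if i = 0 then \<Delta> else 0))"
    and LL_coeff: "(if j = 0 then \<Delta> * a (Suc i) else 0) + a (Suc j) * shift_coeff x (n - Suc j) i
      - (if i = 0 then \<Delta> * a (Suc j) else 0) - a (Suc i) * shift_coeff x (n - Suc i) j
      = (a (Suc (i + j)) + b (Suc (i + j)))
        * (of_nat (Suc (i + j) choose Suc j) - of_nat (Suc (i + j) choose j))"
proof -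
  \<comment> \<open>the five terms of the defect at \<open>y = 1\<close>, as polynomials in \<open>m\<close> over \<open>\<complex>[l]\<close>\<close>
  define A where "A = (\<Sum>i\<le>n. monom (a i) i)"
  define T1 where "T1 = [: [:1,1:], [:\<Delta>:] :] * [:A:]"
  define T2 where "T2 = (\<Sum>j\<le>n. monom ([:1,x:] * [:1,1:]^(n-j) * [:a j:]) j)"
  define T3 where "T3 = [: [:1,\<Delta>:], 1 :] * (\<Sum>j\<le>n. monom [:a j:] j)"
  define T4 where "T4 = (\<Sum>i\<le>n. smult (monom (a i) i) ([: 1, [:x:] :] * [:1,1:]^(n-i)))"
  define S where "S = (\<Sum>k\<le>n. smult [:a k + b k:] ([: [:0,1:], 1:]^k))"
  define T5 where "T5 = [: [:0,1:], -1 :] * S"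
  have cA: "coeff A i = a i" for i
    using a0 by (auto simp: A_def coeff_sum)
  have s0: "n < k \<Longrightarrow> a k + b k = 0" for k using a0 b0 by simp
  have "T1 + T2 - T3 - T4 - T5 = 0"
  proof (rule bipoly_eq_0)
    fix l m
    show "poly (poly (T1 + T2 - T3 - T4 - T5) [:m:]) l = 0"
      using LL [of l m]
      unfolding LL_defect_def hform_def T1_def T2_def T3_def T4_def T5_def A_def S_def
      by (simp add: poly_sum poly_monom algebra_simps sum_distrib_left sum.distrib sum_subtractf)
  qed
  then have *: "bicoeff (T1 + T2 - T3 - T4 - T5) i j = 0" for i j by simp
  have c1: "bicoeff T1 (Suc i) (Suc j) = (if j = 0 then \<Delta> * a (Suc i) else 0)"
      "bicoeff T1 (Suc i) 0 = a (Suc i) + a i" for i j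
    by (auto simp: T1_def cA coeff_pCons split: nat.splits)
  have c2: "bicoeff T2 (Suc i) j = a j * shift_coeff x (n - j) i" for i j
    using a0 by (simp add: T2_def coeff_sum shift_coeff_def coeff_1_1_power)
  have c3: "bicoeff T3 (Suc i) (Suc j) = (if i = 0 then \<Delta> * a (Suc j) else 0)"
    "bicoeff T3 (Suc i) 0 = (if i = 0 then \<Delta> * a 0 else 0)" for i j
    using a0 by (auto simp: T3_def coeff_sum  coeff_pCons split: nat.splits)
  have c4: "bicoeff T4 i (Suc j) = a i * shift_coeff x (n - i) j" "bicoeff T4 i 0 = a i" for i j
  proof -
    have "monom (a i) i * [:c:] = monom (a i * c) i" for i c
      by (simp add: smult_monom mult.commute)
    then have "coeff T4 (Suc j) = (\<Sum>i\<le>n. monom (a i * shift_coeff x (n - i) j) i)"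
      by (simp only: T4_def coeff_sum coeff_smult coeff_shift_poly)
    then show "bicoeff T4 i (Suc j) = a i * shift_coeff x (n - i) j"
      using a0 by (simp add: coeff_sum)
    show "bicoeff T4 i 0 = a i"
      using a0 by (simp add: T4_def coeff_sum coeff_1_1_power)
  qed
  have cS: "bicoeff S i j = (a (i + j) + b (i + j)) * of_nat (i + j choose j)" for i j
  proof -
    have *: "coeff ([:[:0, 1:], 1:] ^ k) j = monom (of_nat (k choose j)) (k - j)" for k
      by (cases "j \<le> k")
        (simp_all add: coeff_linear_poly_power binomial_eq_0 coeff_eq_0 le_less_trans [OF degree_power_le]
           monom_altdef of_nat_poly)
    have "bicoeff S i j = (\<Sum>k\<le>n. if k = i + j then (a k + b k) * of_nat (k choose j) else 0)"
      unfolding S_def coeff_sum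
      by (intro sum.cong refl) (auto simp: * binomial_eq_0)
    then show ?thesis using s0 [of "i + j"] by auto
  qed
  have c5: "bicoeff T5 (Suc i) (Suc j) = (a (Suc (i + j)) + b (Suc (i + j)))
        * (of_nat (Suc (i + j) choose Suc j) - of_nat (Suc (i + j) choose j))"
    "bicoeff T5 (Suc i) 0 = a i + b i" for i j
    by (simp_all add: T5_def cS algebra_simps)
  show "b i = a 0 * (shift_coeff x n i - (if i = 0 then \<Delta> else 0))"
    using * [where i = "Suc i" and j = 0] by (simp add: c1 c2 c3 c4 c5 algebra_simps)
  show "(if j = 0 then \<Delta> * a (Suc i) else 0) + a (Suc j) * shift_coeff x (n - Suc j) i
      - (if i = 0 then \<Delta> * a (Suc j) else 0) - a (Suc i) * shift_coeff x (n - Suc i) j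
      = (a (Suc (i + j)) + b (Suc (i + j)))
        * (of_nat (Suc (i + j) choose Suc j) - of_nat (Suc (i + j) choose j))"
    using * [where i = "Suc i" and j = "Suc j"] by (simp add: c1 c2 c3 c4 c5)
qed

lemma LI_coeffs:
  assumes b0: "\<And>i. n < i \<Longrightarrow> b i = 0"
    and LI: "\<And>l m. LI_defect x \<Delta> (hform n b) 1 l m = 0"
  shows LI_coeff_0: "b 0 * (shift_coeff x n i - (if i = 0 then \<Delta> else 0)) = 0"
    and LI_coeff_1: "b 1 * (shift_coeff x (n - 1) i - (if i = 0 then \<Delta> else 0)) = - b (Suc i)"
proof -
  define T2 where "T2 = (\<Sum>j\<le>n. monom ([:1,x:] * [:1,1:]^(n-j) * [:b j:]) j)"
  define T3 where "T3 = [: [:1,\<Delta>:], 1 :] * (\<Sum>j\<le>n. monom [:b j:] j)"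
  define S where "S = (\<Sum>k\<le>n. smult [:b k:] ([: [:0,1:], 1:]^k))"
  have "T2 - T3 + [:0, 1:] * S = 0"
  proof (rule bipoly_eq_0)
    fix l m
    show "poly (poly (T2 - T3 + [:0, 1:] * S) [:m:]) l = 0"
      using LI [of l m]
      unfolding LI_defect_def hform_def T2_def T3_def S_def
      by (simp add: poly_sum poly_monom algebra_simps sum_distrib_left sum.distrib sum_subtractf)
  qed
  then have *: "bicoeff (T2 - T3 + [:0, 1:] * S) i j = 0" for i j by simp
  have c2: "bicoeff T2 (Suc i) j = b j * shift_coeff x (n - j) i" for i j
    using b0 by (simp add: T2_def coeff_sum shift_coeff_def coeff_1_1_power)
  have c3: "bicoeff T3 (Suc i) (Suc j) = (if i = 0 then \<Delta> * b (Suc j) else 0)"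
    "bicoeff T3 (Suc i) 0 = (if i = 0 then \<Delta> * b 0 else 0)" for i j
    using b0 by (auto simp: T3_def coeff_sum coeff_pCons split: nat.splits)
  have cS: "bicoeff S i 0 = b i" for i
    using b0 by (simp add: S_def coeff_sum coeff_linear_poly_power monom_altdef [of 1, simplified, symmetric]
        if_distrib cong: if_cong)
  show "b 0 * (shift_coeff x n i - (if i = 0 then \<Delta> else 0)) = 0"
    using * [where i = "Suc i" and j = 0] by (simp add: c2 c3 algebra_simps)
  show "b 1 * (shift_coeff x (n - 1) i - (if i = 0 then \<Delta> else 0)) = - b (Suc i)"
    using * [where i = "Suc i" and j = "Suc 0"] by (simp add: c2 c3 cS algebra_simps add_eq_0_iff)
qed

text \<open>
  The coefficient of \<open>y\<^sup>m\<^sup>+\<^sup>1\<^sup>-\<^sup>il\<^sup>i\<close> in the coboundary of \<open>y\<^sup>m\<close>.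
\<close>

definition cobound_coeff :: "complex \<Rightarrow> complex \<Rightarrow> nat \<Rightarrow> nat \<Rightarrow> complex" where
  "cobound_coeff x \<Delta> m i = (case i of 0 \<Rightarrow> 0 | Suc k \<Rightarrow> shift_coeff x m k - (if k = 0 then \<Delta> else 0))"

lemma shift_coeff_simps:
  "shift_coeff x m 0 = of_nat m + x" "shift_coeff x m m = x" "shift_coeff x (Suc m) m = 1 + x * of_nat (Suc m)"
  "m < i \<Longrightarrow> shift_coeff x m i = 0"
  by (simp_all add: shift_coeff_def binomial_eq_0)

lemma hform_cobound_coeff: "hform (Suc m) (\<lambda>i. t * cobound_coeff x \<Delta> m i) y l = coboundary x \<Delta> (\<lambda>y. t * y ^ m) y l"
proof -
  have "(y + l) ^ m = (l + y) ^ m" by (simp add: add.commute)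
  then have e: "(y + l) ^ m = (\<Sum>k\<le>m. of_nat (m choose k) * l ^ k * y ^ (m - k))"
    by (simp only: binomial_ring)
  have "y * (y + l) ^ m = (\<Sum>k\<le>m. of_nat (m choose k) * l ^ k * y ^ (Suc m - k))"
    unfolding e sum_distrib_left by (intro sum.cong) (auto simp: Suc_diff_le mult_ac)
  also have "\<dots> = (\<Sum>k\<le>Suc m. of_nat (m choose k) * l ^ k * y ^ (Suc m - k))"
    by (simp add: binomial_eq_0)
  also have "\<dots> = y ^ Suc m + (\<Sum>k\<le>m. of_nat (m choose Suc k) * l ^ Suc k * y ^ (m - k))"
    by (simp add: sum.atMost_Suc_shift del: sum.atMost_Suc)
  finally have e1: "y * (y + l) ^ m = \<dots>" .
  have "hform (Suc m) (\<lambda>i. t * cobound_coeff x \<Delta> m i) y l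
      = (\<Sum>k\<le>m. t * (shift_coeff x m k - (if k = 0 then \<Delta> else 0)) * y ^ (m - k) * l ^ Suc k)"
    by (simp add: hform_def cobound_coeff_def sum.atMost_Suc_shift del: sum.atMost_Suc)
  also have "\<dots> = t * ((\<Sum>k\<le>m. of_nat (m choose Suc k) * l ^ Suc k * y ^ (m - k))
      + x * l * (\<Sum>k\<le>m. of_nat (m choose k) * l ^ k * y ^ (m - k))
      - (\<Sum>k\<le>m. if k = 0 then \<Delta> * l * y ^ m else 0))"
    unfolding shift_coeff_def sum_distrib_left sum.distrib [symmetric] sum_subtractf [symmetric]
    by (intro sum.cong) (auto simp: algebra_simps)
  also have "\<dots> = coboundary x \<Delta> (\<lambda>y. t * y ^ m) y l"
    unfolding e [symmetric] using e1 by (simp add: coboundary_def algebra_simps)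
  finally show ?thesis .
qed

definition homogeneous_cocycle :: "complex \<Rightarrow> complex \<Rightarrow> nat \<Rightarrow> (nat \<Rightarrow> complex) \<Rightarrow> (nat \<Rightarrow> complex) \<Rightarrow> bool" where
  "homogeneous_cocycle x \<Delta> n a b \<longleftrightarrow> (\<forall>i>n. a i = 0) \<and> (\<forall>i>n. b i = 0)
     \<and> (\<forall>y l m. LL_defect x \<Delta> (hform n a) (hform n b) y l m = 0)
     \<and> (\<forall>y l m. LI_defect x \<Delta> (hform n b) y l m = 0)"

lemma hform_diff: "hform n (\<lambda>i. a i - t * c i) y l = hform n a y l - t * hform n c y l"
  by (simp add: hform_def algebra_simps sum_subtractf sum_distrib_left)

lemma homogeneous_cocycle_diff:
  assumes a: "homogeneous_cocycle x \<Delta> n a b" and c: "homogeneous_cocycle x \<Delta> n c (\<lambda>_. 0)"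
  shows "homogeneous_cocycle x \<Delta> n (\<lambda>i. a i - t * c i) b"
proof -
  have "LL_defect x \<Delta> (hform n (\<lambda>i. a i - t * c i)) (hform n b) y l m
    = LL_defect x \<Delta> (hform n a) (hform n b) y l m - t * LL_defect x \<Delta> (hform n c) (hform n (\<lambda>_. 0)) y l m"
    for y l m
    by (simp add: LL_defect_def hform_diff algebra_simps) (simp add: hform_def)
  then show ?thesis using a c by (simp add: homogeneous_cocycle_def)
qed

lemma homogeneous_cocycle_cobound_coeff: "homogeneous_cocycle x \<Delta> (Suc m) (cobound_coeff x \<Delta> m) (\<lambda>_. 0)"
proof -
  have h: "hform (Suc m) (cobound_coeff x \<Delta> m) = coboundary x \<Delta> (\<lambda>y. y ^ m)"
    using hform_cobound_coeff [of m 1] by (simp add: fun_eq_iff)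
  have "hform (Suc m) (\<lambda>_. 0) = (\<lambda>_ _. 0)" by (simp add: hform_def fun_eq_iff)
  then show ?thesis
    unfolding homogeneous_cocycle_def h by (auto simp: LL_defect_coboundary LI_defect_def cobound_coeff_def shift_coeff_simps split: nat.split)
qed

section \<open>Homogeneous cocycles\<close>

context
  fixes x \<Delta> :: complex and n :: nat and a b :: "nat \<Rightarrow> complex"
  assumes h: "homogeneous_cocycle x \<Delta> n a b" and x: "x \<noteq> 0"
begin

lemma a_beyond: "n < i \<Longrightarrow> a i = 0" and b_beyond: "n < i \<Longrightarrow> b i = 0"
  and LL_eq_0: "LL_defect x \<Delta> (hform n a) (hform n b) y l m = 0"
  and LI_eq_0: "LI_defect x \<Delta> (hform n b) y l m = 0"
  using h by (auto simp: homogeneous_cocycle_def)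

lemma b_eq: "b i = a 0 * cobound_coeff x \<Delta> n (Suc i)"
  using LL_coeff_0 [OF a_beyond b_beyond LL_eq_0] by (simp add: cobound_coeff_def)

lemma b_0_relation: "b 0 * cobound_coeff x \<Delta> n (Suc i) = 0"
  using LI_coeff_0 [OF b_beyond LI_eq_0] by (simp add: cobound_coeff_def)

lemma b_1_relation: "b 1 * cobound_coeff x \<Delta> (n - 1) (Suc i) = - b (Suc i)"
  using LI_coeff_1 [OF b_beyond LI_eq_0] by (simp add: cobound_coeff_def)

text \<open>
  Taking the coefficient of \<open>m\<close> in the defect is a contracting homotopy away from degree
  \<open>\<Delta> - \<Delta>' + 1\<close>: it expresses a multiple of \<open>a\<close> by \<open>b\<close> and the coboundary of \<open>y\<^sup>n\<^sup>-\<^sup>1\<close>.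
\<close>

lemma a_relation:
  assumes "0 < n"
  shows "(\<Delta> - x + 1 - of_nat n) * a (Suc i) = of_nat i * b (Suc i) - a 1 * cobound_coeff x \<Delta> (n - 1) (Suc i)"
proof (cases "Suc i \<le> n")
  case True
  have "\<Delta> * a (Suc i) + a 1 * shift_coeff x (n - 1) i - (if i = 0 then \<Delta> * a 1 else 0)
      - a (Suc i) * shift_coeff x (n - Suc i) 0 = (a (Suc i) + b (Suc i)) * (of_nat (Suc i) - 1)"
    using LL_coeff [OF a_beyond b_beyond LL_eq_0, of 0 i] by (cases i) simp_all
  then show ?thesis
    using True by (auto simp: cobound_coeff_def shift_coeff_simps algebra_simps)
next
  case False
  then show ?thesis
    using assms by (auto simp: a_beyond b_beyond cobound_coeff_def shift_coeff_simps)
qed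

text \<open>
  Since \<open>b\<close> is determined by \<open>a 0\<close>, the equation for \<open>b\<close> alone restricts \<open>n\<close>. For \<open>n \<ge> 1\<close>
  the useful coefficients are the top ones, which are \<open>x\<close> or \<open>1 + kx\<close>: they give \<open>b 0 = 0\<close>, hence
  \<open>n = \<Delta> - \<Delta>'\<close>, then \<open>b 1 = - a 0\<close> for \<open>n \<ge> 2\<close>, and they contradict each other for \<open>n \<ge> 3\<close>.
\<close>

lemma a0_nonzero_imp:
  assumes "a 0 \<noteq> 0"
  shows "of_nat n = \<Delta> - x" and "n \<le> 2" and "n = 2 \<Longrightarrow> x = -1"
proof -
  have d: "b 0 = a 0 * (of_nat n + x - \<Delta>)"
    using b_eq [of 0] by (simp add: cobound_coeff_def shift_coeff_simps)
  have b0: "b 0 = 0"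
  proof (cases "n = 0")
    case True
    then show ?thesis using b_0_relation [of 0] d assms by (auto simp: cobound_coeff_def shift_coeff_simps)
  next
    case False
    then show ?thesis using b_0_relation [of n] x by (auto simp: cobound_coeff_def shift_coeff_simps)
  qed
  then have "of_nat n + x - \<Delta> = 0" using d assms by simp
  then show "of_nat n = \<Delta> - x" by (simp add: algebra_simps)
  have b1: "b 1 = - a 0" if "2 \<le> n"
  proof -
    from that obtain k where n: "n = Suc (Suc k)" by (metis Suc_le_D numeral_2_eq_2 Suc_le_mono)
    have "b 1 * x = - a 0 * x"
      using b_1_relation [of "Suc k"] b_eq [of n] by (simp add: n cobound_coeff_def shift_coeff_simps)
    then show "b 1 = - a 0" using x by (simp add: minus_mult_left del: mult_minus_left)
  qed
  show "n \<le> 2"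
  proof (rule ccontr)
    assume "\<not> n \<le> 2"
    then obtain k where n: "n = Suc (Suc (Suc k))"
      by (metis Suc_le_D numeral_2_eq_2 Suc_le_mono not_less_eq_eq)
    have "b 1 * (1 + x * of_nat (Suc (Suc k))) = - a 0 * (1 + x * of_nat n)"
      using b_1_relation [of "Suc k"] b_eq [of "Suc (Suc k)"] by (simp add: n cobound_coeff_def shift_coeff_simps)
    then show False using b1 assms x by (simp add: n algebra_simps)
  qed
  assume n: "n = 2"
  show "x = -1"
  proof -
    have "a 0 * (2 * (x + 1)) = 0"
      using b1 b_eq [of 1] by (simp add: n cobound_coeff_def shift_coeff_def eval_nat_numeral algebra_simps)
    then show ?thesis using assms by (simp add: add_eq_0_iff2)
  qed
qed

lemma b_eq_0: "a 0 = 0 \<Longrightarrow> b = (\<lambda>_. 0)"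
  using b_eq by (simp add: fun_eq_iff)

lemma noncritical:
  assumes "of_nat n \<noteq> \<Delta> - x" and "of_nat n \<noteq> \<Delta> - x + 1"
  shows "b = (\<lambda>_. 0)" and "\<exists>t. \<forall>y l. hform n a y l = coboundary x \<Delta> (\<lambda>y. t * y ^ (n - 1)) y l"
proof -
  have a0: "a 0 = 0" using a0_nonzero_imp assms by blast
  then show b: "b = (\<lambda>_. 0)" by (rule b_eq_0)
  show "\<exists>t. \<forall>y l. hform n a y l = coboundary x \<Delta> (\<lambda>y. t * y ^ (n - 1)) y l"
  proof (cases n)
    case 0
    then show ?thesis using a0 by (intro exI [of _ 0]) (simp add: hform_def coboundary_def)
  next
    case (Suc m)
    define t where "t = - a 1 / (\<Delta> - x + 1 - of_nat n)"
    have "a i = t * cobound_coeff x \<Delta> m i" for i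
    proof (cases i)
      case (Suc k)
      then show ?thesis using a_relation [of k] assms(2) \<open>n = Suc m\<close>
        by (simp add: t_def b field_simps)
    qed (simp add: a0 cobound_coeff_def)
    then have "a = (\<lambda>i. t * cobound_coeff x \<Delta> m i)" by blast
    then show ?thesis using Suc by (auto simp: hform_cobound_coeff)
  qed
qed

text \<open>
  Here \<open>\<Delta> - \<Delta>' + 1 - n = 1\<close>, so \<open>a\<close> is the sum of a coboundary and the terms that \<open>b\<close> contributes;
  \<open>a 0\<close> is kept since coboundaries vanish at \<open>l = 0\<close>.
\<close>

lemma subcritical:
  assumes "of_nat n = \<Delta> - x"
  shows "\<exists>t. \<forall>y l. hform n a y l = coboundary x \<Delta> (\<lambda>y. t * y ^ (n - 1)) y l
     + hform n (\<lambda>i. if i = 0 then a 0 else of_nat (i - 1) * b i) y l"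
proof (cases n)
  case 0
  then show ?thesis by (intro exI [of _ 0]) (simp add: hform_def coboundary_def)
next
  case (Suc m)
  have "a i - (- a 1) * cobound_coeff x \<Delta> m i = (if i = 0 then a 0 else of_nat (i - 1) * b i)" for i
  proof (cases i)
    case (Suc k)
    have "\<Delta> - x + 1 - of_nat n = 1" using assms by simp
    then have "a (Suc k) = of_nat k * b (Suc k) - a 1 * cobound_coeff x \<Delta> m (Suc k)"
      using a_relation [of k] \<open>n = Suc m\<close> by simp
    then show ?thesis using Suc by simp
  qed (simp add: cobound_coeff_def)
  then have "hform n (\<lambda>i. if i = 0 then a 0 else of_nat (i - 1) * b i) y l
    = hform n (\<lambda>i. a i - (- a 1) * cobound_coeff x \<Delta> m i) y l" for y l
    by simp
  then have "hform n a y l = hform n (\<lambda>i. - a 1 * cobound_coeff x \<Delta> m i) y l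
     + hform n (\<lambda>i. if i = 0 then a 0 else of_nat (i - 1) * b i) y l" for y l
    unfolding hform_diff by (simp add: hform_def sum_distrib_left mult_ac)
  moreover have "hform n (\<lambda>i. - a 1 * cobound_coeff x \<Delta> m i) y l = coboundary x \<Delta> (\<lambda>y. - a 1 * y ^ (n - 1)) y l" for y l
    using hform_cobound_coeff [of m "- a 1"] Suc by simp
  ultimately show ?thesis by (intro exI [of _ "- a 1"]) simp
qed

text \<open>
  In degree \<open>\<Delta> - \<Delta>' + 1\<close> the homotopy says that \<open>a 1\<close> times the coboundary of \<open>y\<^sup>n\<^sup>-\<^sup>1\<close> vanishes. The
  top coefficient of this coboundary is \<open>x \<noteq> 0\<close>.
\<close>

lemma critical_low_coefficients:
  assumes "of_nat n = \<Delta> - x + 1"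
  shows "a 0 = 0" and "b = (\<lambda>_. 0)" and "2 \<le> n \<Longrightarrow> a 1 = 0"
proof -
  show a0: "a 0 = 0" using a0_nonzero_imp(1) assms by auto
  then show b: "b = (\<lambda>_. 0)" by (rule b_eq_0)
  assume "2 \<le> n"
  then obtain k where n: "n = Suc (Suc k)" by (metis Suc_le_D numeral_2_eq_2 Suc_le_mono)
  have "\<Delta> - x + 1 - of_nat n = 0" using assms by simp
  then show "a 1 = 0"
    using a_relation [of "Suc k"] x n by (simp add: b cobound_coeff_def shift_coeff_simps)
qed

lemma critical_relation_Suc:
  assumes "of_nat n = \<Delta> - x + 1"
  shows "a (Suc (Suc j)) * shift_coeff x (n - Suc (Suc j)) (Suc i) - a (Suc (Suc i)) * shift_coeff x (n - Suc (Suc i)) (Suc j)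
      = a (Suc (Suc (Suc (i + j)))) * (of_nat (Suc (Suc (Suc (i + j))) choose Suc (Suc j))
           - of_nat (Suc (Suc (Suc (i + j))) choose Suc j))"
  using LL_coeff [OF a_beyond b_beyond LL_eq_0, of "Suc j" "Suc i"] critical_low_coefficients(2) [OF assms] by simp

text \<open>
  The relation of \<open>l\<^sup>2m\<^sup>j\<close> computes \<open>a (j + 1)\<close> from \<open>a 2\<close> and \<open>a j\<close>, because for \<open>j \<ge> 3\<close> the two
  binomial coefficients on its right-hand side differ.
\<close>

lemma critical_eq_0:
  assumes n: "of_nat n = \<Delta> - x + 1" "2 \<le> n" and a23: "a 2 = 0" "a 3 = 0"
  shows "a = (\<lambda>_. 0)"
proof -
  have "a i = 0" for i
  proof (induction i rule: less_induct)
    case (less i)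
    show ?case
    proof (cases "i \<le> 3")
      case True
      then have "i = 0 \<or> i = 1 \<or> i = 2 \<or> i = 3" by auto
      then show ?thesis using critical_low_coefficients [OF n(1)] n(2) a23 by auto
    next
      case False
      define j where "j = i - 3"
      have i: "i = Suc (Suc (Suc j))" and j: "j > 0" using False by (auto simp: j_def)
      have "Suc (Suc (Suc j)) choose Suc (Suc j) \<noteq> Suc (Suc (Suc j)) choose Suc j"
      proof -
        have "Suc (Suc (Suc j)) choose Suc j = Suc (Suc (Suc j)) choose 2"
          using binomial_symmetric [of 2 "Suc (Suc (Suc j))"] by simp
        moreover have "2 * (Suc (Suc (Suc j)) choose 2) = Suc (Suc (Suc j)) * Suc (Suc j)"
          by (simp add: choose_two)
        moreover have "Suc (Suc (Suc j)) choose Suc (Suc j) = Suc (Suc (Suc j))"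
          using binomial_Suc_n [of "Suc (Suc j)"] by simp
        ultimately show ?thesis using j by auto
      qed
      then show ?thesis
        using critical_relation_Suc [OF n(1), where i = 0 and j = j] less.IH [of "Suc (Suc j)"] a23 i
        by (simp add: eval_nat_numeral)
    qed
  qed
  then show ?thesis by blast
qed

lemma critical_relation:
  assumes "of_nat n = \<Delta> - x + 1" "2 \<le> i" "2 \<le> j"
  shows "a j * shift_coeff x (n - j) (i - 1) - a i * shift_coeff x (n - i) (j - 1)
      = a (i + j - 1) * (of_nat (i + j - 1 choose j) - of_nat (i + j - 1 choose (j - 1)))"
proof -
  obtain i' j' where "i = Suc (Suc i')" "j = Suc (Suc j')"
    using assms(2,3) by (metis Suc_le_D numeral_2_eq_2 Suc_le_mono)
  then show ?thesis using critical_relation_Suc [OF assms(1), of j' i'] by simp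
qed

section \<open>Relations in the critical degree\<close>

lemma choose_numerals:
  "(4::nat) choose 3 = 4" "(4::nat) choose 2 = 6" "(5::nat) choose 4 = 5" "(5::nat) choose 3 = 10"
  "(6::nat) choose 5 = 6" "(6::nat) choose 4 = 15" "(6::nat) choose 3 = 20"
  "(7::nat) choose 6 = 7" "(7::nat) choose 5 = 21"
  "(8::nat) choose 7 = 8" "(8::nat) choose 6 = 28" "(8::nat) choose 5 = 56"
  by (simp_all add: eval_nat_numeral)

text \<open>
  The relations of \<open>l\<^sup>2m\<^sup>j\<close> for \<open>j = 3, \<dots>, 7\<close>, which successively determine \<open>a 4, \<dots>, a 8\<close>, and the
  relations of \<open>l\<^sup>3m\<^sup>4\<close> and \<open>l\<^sup>3m\<^sup>6\<close>, which determine \<open>a 6\<close> and \<open>a 8\<close> again.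
\<close>

lemma critical_relations:
  assumes "of_nat n = \<Delta> - x + 1"
  shows "- 2 * a 4 = a 3 * shift_coeff x (n - 3) 1 - a 2 * shift_coeff x (n - 2) 2"
    and "- 5 * a 5 = a 4 * shift_coeff x (n - 4) 1 - a 2 * shift_coeff x (n - 2) 3"
    and "- 9 * a 6 = a 5 * shift_coeff x (n - 5) 1 - a 2 * shift_coeff x (n - 2) 4"
    and "- 14 * a 7 = a 6 * shift_coeff x (n - 6) 1 - a 2 * shift_coeff x (n - 2) 5"
    and "- 20 * a 8 = a 7 * shift_coeff x (n - 7) 1 - a 2 * shift_coeff x (n - 2) 6"
    and "- 5 * a 6 = a 4 * shift_coeff x (n - 4) 2 - a 3 * shift_coeff x (n - 3) 3"
    and "- 28 * a 8 = a 6 * shift_coeff x (n - 6) 2 - a 3 * shift_coeff x (n - 3) 5"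
  using critical_relation [OF assms, of 2 3] critical_relation [OF assms, of 2 4]
    critical_relation [OF assms, of 2 5] critical_relation [OF assms, of 2 6]
    critical_relation [OF assms, of 2 7] critical_relation [OF assms, of 3 4]
    critical_relation [OF assms, of 3 6]
  by (simp_all add: choose_numerals)

end

lemma shift_coeff_expand:
  "shift_coeff x m 1 = of_nat m * (of_nat m - 1) / 2 + x * of_nat m"
  "shift_coeff x m 2 = of_nat m * (of_nat m - 1) * (of_nat m - 2) / 6 + x * (of_nat m * (of_nat m - 1) / 2)"
  "shift_coeff x m 3 = of_nat m * (of_nat m - 1) * (of_nat m - 2) * (of_nat m - 3) / 24
     + x * (of_nat m * (of_nat m - 1) * (of_nat m - 2) / 6)"
  "shift_coeff x m 4 = of_nat m * (of_nat m - 1) * (of_nat m - 2) * (of_nat m - 3) * (of_nat m - 4) / 120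
     + x * (of_nat m * (of_nat m - 1) * (of_nat m - 2) * (of_nat m - 3) / 24)"
  "shift_coeff x m 5 = of_nat m * (of_nat m - 1) * (of_nat m - 2) * (of_nat m - 3) * (of_nat m - 4) * (of_nat m - 5) / 720
     + x * (of_nat m * (of_nat m - 1) * (of_nat m - 2) * (of_nat m - 3) * (of_nat m - 4) / 120)"
  by (simp_all add: shift_coeff_def binomial_gbinomial gbinomial_prod_rev numeral_eq_Suc lessThan_Suc fact_numeral)

lemma solve_numeral_multiple: "- numeral k * (a::complex) = X \<Longrightarrow> a = - X / numeral k"
  by (auto simp: field_simps)

context
  fixes x \<Delta> N :: complex and n :: nat and a b :: "nat \<Rightarrow> complex"
  assumes h: "homogeneous_cocycle x \<Delta> n a b" "x \<noteq> 0" and n: "of_nat n = \<Delta> - x + 1" and N: "N = of_nat n"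
begin

text \<open>
  In terms of \<open>w\<close>, which vanishes exactly when the coboundary of \<open>y\<^sup>n\<^sup>-\<^sup>1\<close> has no term in \<open>l\<^sup>2\<close>, every
  coefficient splits off its factors \<open>N - k\<close>. This keeps the two elimination steps below small.
\<close>

lemma shift_coeff_factored:
  fixes w :: complex
  defines "w \<equiv> x + (N - 2) / 2"
  shows
  "2 \<le> n \<Longrightarrow> shift_coeff x (n - 2) 2 = (N - 3) * ((N - 2) / 2 * (w - (N + 2) / 6))"
  "2 \<le> n \<Longrightarrow> shift_coeff x (n - 2) 3 = (N - 3) * (N - 4) * ((N - 2) / 6 * (w - (N + 1) / 4))"
  "2 \<le> n \<Longrightarrow> shift_coeff x (n - 2) 4 = (N - 3) * (N - 4) * (N - 5) * ((N - 2) / 24 * (w - (3 * N + 2) / 10))"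
  "3 \<le> n \<Longrightarrow> shift_coeff x (n - 3) 1 = (N - 3) * (w - 1)"
  "4 \<le> n \<Longrightarrow> shift_coeff x (n - 4) 1 = (N - 4) * (w - 3 / 2)"
  "5 \<le> n \<Longrightarrow> shift_coeff x (n - 5) 1 = (N - 5) * (w - 2)"
  "6 \<le> n \<Longrightarrow> shift_coeff x (n - 6) 1 = (N - 6) * (w - 5 / 2)"
  "7 \<le> n \<Longrightarrow> shift_coeff x (n - 7) 1 = (N - 7) * (w - 3)"
  "4 \<le> n \<Longrightarrow> shift_coeff x (n - 4) 2 = (N - 4) * (N - 5) * ((w - N / 6 - 1) / 2)"
  "6 \<le> n \<Longrightarrow> shift_coeff x (n - 6) 2 = (N - 6) * (N - 7) * ((w - N / 6 - 5 / 3) / 2)"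
  "3 \<le> n \<Longrightarrow> shift_coeff x (n - 3) 3 = (N - 3) * (N - 4) * (N - 5) * ((w - N / 4 - 1 / 2) / 6)"
  "3 \<le> n \<Longrightarrow> shift_coeff x (n - 3) 5 = (N - 3) * (N - 4) * (N - 5) * (N - 6) * (N - 7) * ((w - N / 3 - 1 / 3) / 120)"
  unfolding w_def
  by (simp_all only: N shift_coeff_expand of_nat_diff) (simp_all add: field_simps)

lemma N_diff_nonzero: "k < n \<Longrightarrow> N - of_nat k \<noteq> 0"
  by (simp add: N)

text \<open>
  The first factor is, up to \<open>N - 1\<close>, the determinant of \<open>(a 2, a 3)\<close> against the coboundary of
  \<open>y\<^sup>n\<^sup>-\<^sup>1\<close>. It must divide the relation, since coboundaries satisfy all relations.
\<close>

lemma weight_five_relation: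
  fixes w :: complex
  defines "w \<equiv> x + (N - 2) / 2"
  assumes "6 \<le> n"
  shows "(w * a 3 - (N - 2) / 2 * (w - N / 6) * a 2) * (w^2 - (3 * N - 2) / 4) = 0" (is "?G = 0")
proof -
  have ks: "2 \<le> n" "3 \<le> n" "4 \<le> n" "5 \<le> n" using assms by auto
  note rel = critical_relations [OF h n]
  note ex = shift_coeff_factored [folded w_def]
  \<comment> \<open>\<open>a k\<close> without its factor \<open>(N - 3) \<dots> (N - k + 1)\<close>\<close>
  define A4 where "A4 = ((N - 2) / 2 * (w - (N + 2) / 6) * a 2 - (w - 1) * a 3) / 2"
  define A5 where "A5 = ((N - 2) / 6 * (w - (N + 1) / 4) * a 2 - (w - 3 / 2) * A4) / 5"
  define A6 where "A6 = ((N - 2) / 24 * (w - (3 * N + 2) / 10) * a 2 - (w - 2) * A5) / 9"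
  have a4: "a 4 = (N - 3) * A4"
    unfolding rel(1) [THEN solve_numeral_multiple] A4_def ex(1) [OF ks(1)] ex(4) [OF ks(2)] by (simp add: field_simps power2_eq_square)
  have a5: "a 5 = (N - 3) * (N - 4) * A5"
    unfolding rel(2) [THEN solve_numeral_multiple] A5_def a4 ex(2) [OF ks(1)] ex(5) [OF ks(3)] by (simp add: field_simps power2_eq_square)
  have a6: "a 6 = (N - 3) * (N - 4) * (N - 5) * A6"
    unfolding rel(3) [THEN solve_numeral_multiple] A6_def a5 ex(3) [OF ks(1)] ex(6) [OF ks(4)] by (simp add: field_simps power2_eq_square)
  have "(N - 3) * (N - 4) * (N - 5) * (A4 * ((w - N / 6 - 1) / 2) - a 3 * ((w - N / 4 - 1 / 2) / 6) + 5 * A6)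
    = a 4 * shift_coeff x (n - 4) 2 - a 3 * shift_coeff x (n - 3) 3 - (- 5 * a 6)"
    unfolding a6 a4 ex(9) [OF ks(3)] ex(11) [OF ks(2)] by (simp add: field_simps power2_eq_square)
  also have "\<dots> = 0" unfolding rel(6) by simp
  finally have "(N - 3) * (N - 4) * (N - 5) * (A4 * ((w - N / 6 - 1) / 2) - a 3 * ((w - N / 4 - 1 / 2) / 6) + 5 * A6) = 0" .
  moreover have "N - 3 \<noteq> 0" "N - 4 \<noteq> 0" "N - 5 \<noteq> 0"
    using assms N_diff_nonzero [of 3] N_diff_nonzero [of 4] N_diff_nonzero [of 5] by auto
  ultimately have "A4 * ((w - N / 6 - 1) / 2) - a 3 * ((w - N / 4 - 1 / 2) / 6) + 5 * A6 = 0"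
    by simp
  moreover have "?G = - 18 * (A4 * ((w - N / 6 - 1) / 2) - a 3 * ((w - N / 4 - 1 / 2) / 6) + 5 * A6)"
    unfolding A6_def A5_def A4_def by (simp add: field_simps power2_eq_square)
  ultimately show ?thesis by simp
qed

text \<open>
  When the second factor above vanishes, \<open>N\<close> is a polynomial in \<open>w\<close>. After normalising \<open>a 2 = 0\<close> by a
  coboundary the two values of \<open>a 8\<close> are multiples of \<open>a 3\<close> by polynomials in \<open>w\<close>, and their
  difference turns out to be a nonzero multiple of \<open>(N - 1) (N - 2) w\<close> times \<open>a 3\<close>.
\<close>

lemma weight_seven_relation:
  fixes w :: complex
  defines "w \<equiv> x + (N - 2) / 2"
  assumes "8 \<le> n" and w2: "w^2 = (3 * N - 2) / 4" and "a 2 = 0"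
  shows "w * a 3 = 0"
proof -
  have ks: "2 \<le> n" "3 \<le> n" "4 \<le> n" "5 \<le> n" "6 \<le> n" "7 \<le> n" using assms by auto
  note ex = shift_coeff_factored [folded w_def]
  have N': "N = (4 * w^2 + 2) / 3" using w2 by (simp add: field_simps)
  define A4 where "A4 = - ((w - 1) * a 3) / 2"
  define A5 where "A5 = - ((w - 3 / 2) * A4) / 5"
  define A6 where "A6 = - ((w - 2) * A5) / 9"
  define A7 where "A7 = - ((w - 5 / 2) * A6) / 14"
  define A8 where "A8 = - ((w - 3) * A7) / 20"
  note rel = critical_relations [OF h n]
  have a4: "a 4 = (N - 3) * A4"
    using rel(1) [THEN solve_numeral_multiple] \<open>a 2 = 0\<close> unfolding A4_def ex(4) [OF ks(2)] by simp
  have a5: "a 5 = (N - 3) * (N - 4) * A5"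
    using rel(2) [THEN solve_numeral_multiple] \<open>a 2 = 0\<close> unfolding A5_def a4 ex(5) [OF ks(3)] by simp
  have a6: "a 6 = (N - 3) * (N - 4) * (N - 5) * A6"
    using rel(3) [THEN solve_numeral_multiple] \<open>a 2 = 0\<close> unfolding A6_def a5 ex(6) [OF ks(4)] by simp
  have a7: "a 7 = (N - 3) * (N - 4) * (N - 5) * (N - 6) * A7"
    using rel(4) [THEN solve_numeral_multiple] \<open>a 2 = 0\<close> unfolding A7_def a6 ex(7) [OF ks(5)] by simp
  have a8: "a 8 = (N - 3) * (N - 4) * (N - 5) * (N - 6) * (N - 7) * A8"
    using rel(5) [THEN solve_numeral_multiple] \<open>a 2 = 0\<close> unfolding A8_def a7 ex(8) [OF ks(6)] by simp
  have "(N - 3) * (N - 4) * (N - 5) * (N - 6) * (N - 7)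
      * (A6 * ((w - N / 6 - 5 / 3) / 2) - a 3 * ((w - N / 3 - 1 / 3) / 120) + 28 * A8)
    = a 6 * shift_coeff x (n - 6) 2 - a 3 * shift_coeff x (n - 3) 5 - (- 28 * a 8)"
    unfolding a8 a6 ex(10) [OF ks(5)] ex(12) [OF ks(2)] by (simp add: field_simps power2_eq_square)
  also have "\<dots> = 0" unfolding rel(7) by simp
  finally have "(N - 3) * (N - 4) * (N - 5) * (N - 6) * (N - 7)
      * (A6 * ((w - N / 6 - 5 / 3) / 2) - a 3 * ((w - N / 3 - 1 / 3) / 120) + 28 * A8) = 0" .
  moreover have "N - 3 \<noteq> 0" "N - 4 \<noteq> 0" "N - 5 \<noteq> 0" "N - 6 \<noteq> 0" "N - 7 \<noteq> 0"
    using assms N_diff_nonzero [of 3] N_diff_nonzero [of 4] N_diff_nonzero [of 5]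
      N_diff_nonzero [of 6] N_diff_nonzero [of 7] by auto
  ultimately have "A6 * ((w - N / 6 - 5 / 3) / 2) - a 3 * ((w - N / 3 - 1 / 3) / 120) + 28 * A8 = 0"
    by simp
  moreover have "(N - 1) * (N - 2) * (w * a 3)
    = 14400 * (A6 * ((w - N / 6 - 5 / 3) / 2) - a 3 * ((w - N / 3 - 1 / 3) / 120) + 28 * A8)"
    unfolding A8_def A7_def A6_def A5_def A4_def N' by (simp add: field_simps power2_eq_square)
  ultimately have "(N - 1) * (N - 2) * (w * a 3) = 0" by simp
  moreover have "N - 1 \<noteq> 0" "N - 2 \<noteq> 0"
    using assms N_diff_nonzero [of 1] N_diff_nonzero [of 2] by auto
  ultimately show ?thesis by simp
qed

end

section \<open>Cocycles of the critical degree\<close>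

lemma hform_zero: "hform n (\<lambda>_. 0) = (\<lambda>_ _. 0)"
  by (simp add: hform_def fun_eq_iff)

lemma hform_nth_default:
  "hform 3 (nth_default 0 [a0,a1,a2,a3]) y l = a0 * y^3 + a1 * y^2 * l + a2 * y * l^2 + a3 * l^3"
  "hform 4 (nth_default 0 [a0,a1,a2,a3,a4]) y l = a0 * y^4 + a1 * y^3 * l + a2 * y^2 * l^2 + a3 * y * l^3 + a4 * l^4"
  "hform 5 (nth_default 0 [a0,a1,a2,a3,a4,a5]) y l
    = a0 * y^5 + a1 * y^4 * l + a2 * y^3 * l^2 + a3 * y^2 * l^3 + a4 * y * l^4 + a5 * l^5"
  "hform 6 (nth_default 0 [a0,a1,a2,a3,a4,a5,a6]) y l
    = a0 * y^6 + a1 * y^5 * l + a2 * y^4 * l^2 + a3 * y^3 * l^3 + a4 * y^2 * l^4 + a5 * y * l^5 + a6 * l^6"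
  "hform 7 (nth_default 0 [a0,a1,a2,a3,a4,a5,a6,a7]) y l
    = a0 * y^7 + a1 * y^6 * l + a2 * y^5 * l^2 + a3 * y^4 * l^3 + a4 * y^3 * l^4 + a5 * y^2 * l^5 + a6 * y * l^6 + a7 * l^7"
  by (simp_all add: hform_def nth_default_def numeral_eq_Suc)

text \<open>
  Representatives of the nontrivial classes in the critical degree \<open>n \<ge> 2\<close>. The entries are the
  coefficients of \<open>y\<^sup>n, y\<^sup>n\<^sup>-\<^sup>1l, \<dots>, l\<^sup>n\<close> in the polynomials \<open>f\<close> of \<open>listed\<close> that come
  with \<open>g = 0\<close> and \<open>\<Delta> \<noteq> \<Delta>'\<close>.
\<close>

inductive critical_cochain :: "complex \<Rightarrow> nat \<Rightarrow> (nat \<Rightarrow> complex) \<Rightarrow> bool" for x where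
  "critical_cochain x 3 (nth_default 0 [0, 0, 2, 1])"
| "critical_cochain x 4 (nth_default 0 [0, 0, 1, 1, 0])"
| "critical_cochain x 5 (nth_default 0 [0, 0, 4, 6, -1, x])"
| "x = -4 \<Longrightarrow> critical_cochain x 6 (nth_default 0 [0, 0, 1, 0, -10, -17, -8])"
| "x^2 + 5 * x + 3/2 = 0 \<Longrightarrow> critical_cochain x 7
    (nth_default 0 [0, 0, 0, 1, - (2 * x + 3), - 3 * x, - (3 * x + 1), - (x + 9/28)])"

text \<open>
  So \<open>c\<close> is independent of the coboundary of \<open>y\<^sup>n\<^sup>-\<^sup>1\<close>, and the two together realise every pair
  \<open>(a 2, a 3)\<close>. The last case needs that \<open>x = -5/2\<close> is not a root of the quadratic equation.
\<close>

lemma critical_cochain_det: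
  assumes "critical_cochain x n c"
  shows "shift_coeff x (n - 1) 1 * c 3 - shift_coeff x (n - 1) 2 * c 2 \<noteq> 0"
  using assms
proof cases
  case 5
  have "2 * x + 5 \<noteq> 0"
  proof
    assume "2 * x + 5 = 0"
    then have "x = - 5/2" by (simp add: field_simps add_eq_0_iff)
    then show False using 5(3) by (simp add: power2_eq_square)
  qed
  moreover have "shift_coeff x (n - 1) 1 * c 3 - shift_coeff x (n - 1) 2 * c 2 = 3 * (2 * x + 5)"
    by (simp add: 5 shift_coeff_def nth_default_def eval_nat_numeral algebra_simps)
  ultimately show ?thesis by (metis mult_eq_0_iff zero_neq_numeral)
qed (simp_all add: shift_coeff_def nth_default_def eval_nat_numeral algebra_simps)

lemma homogeneous_cocycle_critical_cochain:
  assumes "critical_cochain x n c"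
  shows "homogeneous_cocycle x (x + of_nat n - 1) n c (\<lambda>_. 0)"
proof -
  have "c i = 0" if "n < i" for i
    using assms that by cases (auto simp: nth_default_def)
  moreover have "LL_defect x (x + of_nat n - 1) (hform n c) (\<lambda>_ _. 0) y l m = 0" for y l m
    using assms
  proof cases
    case 1
    show ?thesis unfolding 1 LL_defect_def hform_nth_default
      by (simp add: eval_nat_numeral algebra_simps)
  next
    case 2
    show ?thesis unfolding 2 LL_defect_def hform_nth_default
      by (simp add: eval_nat_numeral algebra_simps)
  next
    case 3
    show ?thesis unfolding 3 LL_defect_def hform_nth_default
      by (simp add: eval_nat_numeral algebra_simps)
  next
    case 4
    show ?thesis unfolding 4 LL_defect_def hform_nth_default
      by (simp add: eval_nat_numeral algebra_simps)
  next
    case 5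
    \<comment> \<open>the part of the cochain that is linear in \<open>x\<close>: the defect is quadratic in \<open>x\<close>, with leading coefficient given by \<open>F1\<close>\<close>
    define F1 where "F1 = (\<lambda>y l :: complex. - 2 * y^3 * l^4 - 3 * y^2 * l^5 - 3 * y * l^6 - l^7)"
    have "LL_defect x (x + of_nat n - 1) (hform n c) (\<lambda>_ _. 0) y l m
      = (x^2 + 5 * x + 3/2) * (m * F1 y l + l * F1 (y + l) m - l * F1 y m - m * F1 (y + m) l)"
      unfolding 5(1,2) LL_defect_def hform_nth_default F1_def
      by (simp add: eval_nat_numeral field_simps)
    then show ?thesis using 5(3) by simp
  qed
  ultimately show ?thesis by (simp add: homogeneous_cocycle_def hform_zero LI_defect_def)
qed

text \<open>
  By \<open>critical_eq_0\<close> a critical cocycle is determined by \<open>(a 2, a 3)\<close>.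
\<close>

lemma critical_spanned:
  assumes h: "homogeneous_cocycle x \<Delta> n a b" "x \<noteq> 0" and n: "of_nat n = \<Delta> - x + 1" "2 \<le> n"
    and c: "homogeneous_cocycle x \<Delta> n c (\<lambda>_. 0)"
    and a2: "a 2 = t * shift_coeff x (n - 1) 1 + s * c 2" and a3: "a 3 = t * shift_coeff x (n - 1) 2 + s * c 3"
  shows "hform n a y l = coboundary x \<Delta> (\<lambda>y. t * y ^ (n - 1)) y l + s * hform n c y l"
proof -
  obtain m where m: "n = Suc m" using n(2) by (cases n) auto
  define a' where "a' = (\<lambda>i. (a i - t * cobound_coeff x \<Delta> m i) - s * c i)"
  have "homogeneous_cocycle x \<Delta> n a' b"
    unfolding a'_def using h(1) homogeneous_cocycle_cobound_coeff [of x \<Delta> m] c m by (intro homogeneous_cocycle_diff) auto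
  moreover have "a' 2 = 0" "a' 3 = 0"
    using a2 a3 m by (simp_all add: a'_def cobound_coeff_def numeral_2_eq_2 numeral_3_eq_3)
  ultimately have "a' = (\<lambda>_. 0)" using critical_eq_0 h(2) n by blast
  then have "hform n a' y l = 0" by (simp add: hform_zero)
  then have "hform n a y l = t * hform n (cobound_coeff x \<Delta> m) y l + s * hform n c y l"
    unfolding a'_def hform_diff by (simp add: algebra_simps)
  moreover have "t * hform n (cobound_coeff x \<Delta> m) y l = hform n (\<lambda>i. t * cobound_coeff x \<Delta> m i) y l"
    by (simp add: hform_def sum_distrib_left mult_ac)
  ultimately show ?thesis using m hform_cobound_coeff by simp
qed

inductive critical_form :: "complex \<Rightarrow> nat \<Rightarrow> (complex \<Rightarrow> complex \<Rightarrow> complex) \<Rightarrow> bool" for x n where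
  "critical_form x n (\<lambda>_ _. 0)"
| "n = 1 \<Longrightarrow> s \<noteq> 0 \<Longrightarrow> critical_form x n (\<lambda>y l. s * l)"
| "critical_cochain x n c \<Longrightarrow> s \<noteq> 0 \<Longrightarrow> critical_form x n (\<lambda>y l. s * hform n c y l)"

lemma solve_2x2:
  fixes k2 k3 c2 c3 a2 a3 :: complex
  assumes "k2 * c3 - k3 * c2 \<noteq> 0"
  shows "\<exists>t s. a2 = t * k2 + s * c2 \<and> a3 = t * k3 + s * c3"
proof (intro exI conjI)
  let ?d = "k2 * c3 - k3 * c2"
  show "a2 = (a2 * c3 - a3 * c2) / ?d * k2 + (k2 * a3 - k3 * a2) / ?d * c2"
   "a3 = (a2 * c3 - a3 * c2) / ?d * k3 + (k2 * a3 - k3 * a2) / ?d * c3"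
    using assms by (simp_all add: divide_simps) (simp_all add: algebra_simps)
qed

lemma proportional:
  fixes k2 k3 a2 a3 :: complex
  assumes "k2 * a3 = k3 * a2" "k2 \<noteq> 0 \<or> k3 \<noteq> 0"
  shows "\<exists>t. a2 = t * k2 \<and> a3 = t * k3"
  using assms by (cases "k2 = 0") (auto intro: exI [of _ "a2 / k2"] exI [of _ "a3 / k3"] simp: field_simps)

text \<open>
  For \<open>2 \<le> n \<le> 5\<close> the coboundary and, from \<open>n = 3\<close> on, one further cochain exhaust all \<open>(a 2, a 3)\<close>. For
  \<open>n \<ge> 6\<close> either \<open>(a 2, a 3)\<close> is proportional to the coboundary, or \<open>w\<^sup>2 = (3n - 2)/4\<close>; the latter means
  \<open>x (x + 4) = 0\<close> for \<open>n = 6\<close> and \<open>x\<^sup>2 + 5x + 3/2 = 0\<close> for \<open>n = 7\<close>.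
\<close>

lemma critical_normal_form:
  assumes h: "homogeneous_cocycle x \<Delta> n a b" "x \<noteq> 0" and n: "of_nat n = \<Delta> - x + 1"
  shows "\<exists>t P. (\<forall>y l. hform n a y l = coboundary x \<Delta> (\<lambda>y. t * y ^ (n - 1)) y l + P y l) \<and> critical_form x n P"
    (is "\<exists>t P. ?S t P \<and> _")
proof -
  have D: "\<Delta> = x + of_nat n - 1" using n by simp
  have zero: ?thesis if "?S t (\<lambda>_ _. 0)" for t
    using that critical_form.intros(1) by (intro exI [of _ t] exI [of _ "\<lambda>_ _. 0"]) simp
  have spanned_by_coboundary: ?thesis if "2 \<le> n" "a 2 = t * shift_coeff x (n - 1) 1" "a 3 = t * shift_coeff x (n - 1) 2" for t
  proof -
    have "homogeneous_cocycle x \<Delta> n (\<lambda>_. 0) (\<lambda>_. 0)"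
      by (simp add: homogeneous_cocycle_def hform_zero LI_defect_def LL_defect_def)
    then have "?S t (\<lambda>_ _. 0)"
      using critical_spanned [OF h n that(1), of "\<lambda>_. 0" t 0] that by simp
    then show ?thesis by (rule zero)
  qed
  have spanned: ?thesis if c: "critical_cochain x n c" for c
  proof -
    have "2 \<le> n" using c by cases auto
    obtain t s where "a 2 = t * shift_coeff x (n - 1) 1 + s * c 2" "a 3 = t * shift_coeff x (n - 1) 2 + s * c 3"
      using solve_2x2 [OF critical_cochain_det [OF c]] by blast
    then have "?S t (\<lambda>y l. s * hform n c y l)"
      using critical_spanned [OF h n \<open>2 \<le> n\<close>, of c] homogeneous_cocycle_critical_cochain [OF c] D by auto
    moreover have "critical_form x n (\<lambda>y l. s * hform n c y l)"
      using c critical_form.intros by (cases "s = 0") auto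
    ultimately show ?thesis by (intro exI [of _ t] exI [of _ "\<lambda>y l. s * hform n c y l"]) simp
  qed
  consider "n = 0" | "n = 1" | "n = 2" | "n \<in> {3, 4, 5}" | "6 \<le> n" by force
  then show ?thesis
  proof cases
    case 1
    then have "?S 0 (\<lambda>_ _. 0)" using critical_low_coefficients(1) [OF h n] by (simp add: hform_def coboundary_def)
    then show ?thesis by (rule zero)
  next
    case 2
    then have "?S 0 (\<lambda>y l. a 1 * l)" using critical_low_coefficients(1) [OF h n] by (simp add: hform_def coboundary_def)
    moreover have "critical_form x n (\<lambda>y l. a 1 * l)"
      using 2 critical_form.intros by (cases "a 1 = 0") auto
    ultimately show ?thesis by (intro exI [of _ 0] exI [of _ "\<lambda>y l. a 1 * l"]) simp
  next
    case 3
    moreover have "a 3 = 0" using h 3 by (simp add: homogeneous_cocycle_def)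
    ultimately show ?thesis using h(2)
      by (intro spanned_by_coboundary [of "a 2 / x"]) (simp_all add: shift_coeff_def eval_nat_numeral)
  next
    case 4
    then show ?thesis using spanned critical_cochain.intros(1-3) by blast
  next
    case 5
    define N :: complex where "N = of_nat n"
    define w where "w = x + (N - 2) / 2"
    have N1: "N - 1 \<noteq> 0" using 5 by (simp add: N_def)
    have k2: "shift_coeff x (n - 1) 1 = (N - 1) * w"
      using 5 by (simp only: shift_coeff_expand N_def w_def of_nat_diff) (simp add: field_simps)
    have k3: "shift_coeff x (n - 1) 2 = (N - 1) * ((N - 2) / 2 * (w - N / 6))"
      using 5 by (simp only: shift_coeff_expand N_def w_def of_nat_diff) (simp add: field_simps)
    have k: "shift_coeff x (n - 1) 1 \<noteq> 0 \<or> shift_coeff x (n - 1) 2 \<noteq> 0"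
    proof -
      have "N \<noteq> of_nat 2" "N \<noteq> 0" using 5 unfolding N_def of_nat_eq_iff by auto
      then show ?thesis unfolding k2 k3 using N1 by (cases "w = 0") auto
    qed
    have five: "(w * a 3 - (N - 2) / 2 * (w - N / 6) * a 2) * (w^2 - (3 * N - 2) / 4) = 0"
      using weight_five_relation [OF h n N_def 5] by (simp add: w_def)
    show ?thesis
    proof (cases "w^2 = (3 * N - 2) / 4")
      case False
      then have "w * a 3 = (N - 2) / 2 * (w - N / 6) * a 2" using five by simp
      then have "shift_coeff x (n - 1) 1 * a 3 = shift_coeff x (n - 1) 2 * a 2"
        unfolding k2 k3 by (simp add: mult.assoc)
      then obtain t where "a 2 = t * shift_coeff x (n - 1) 1" "a 3 = t * shift_coeff x (n - 1) 2"
        using proportional [OF _ k] by blast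
      then show ?thesis using 5 by (intro spanned_by_coboundary) auto
    next
      case True
      have "w \<noteq> 0"
      proof
        assume "w = 0"
        then have "of_nat (3 * n) = (of_nat 2 :: complex)" using True by (simp add: N_def)
        then show False using 5 unfolding of_nat_eq_iff by simp
      qed
      consider "n = 6" | "n = 7" | "8 \<le> n" using 5 by linarith
      then show ?thesis
      proof cases
        case 1
        have "x * (x + 4) = 0"
          using True by (simp add: w_def N_def 1 field_simps power2_eq_square)
        then have x: "x = -4" using h(2) by (simp add: add_eq_0_iff2)
        then show ?thesis using 1 spanned critical_cochain.intros(4) by blast
      next
        case 2
        have x: "x^2 + 5 * x + 3/2 = 0"
        proof -
          have "x^2 + 5 * x + 3/2 = w^2 - (3 * N - 2) / 4"
            by (simp add: w_def N_def 2 field_simps power2_eq_square)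
          then show ?thesis using True by simp
        qed
        then show ?thesis using 2 spanned critical_cochain.intros(5) by blast
      next
        case 3
        obtain m where m: "n = Suc m" using 5 by (cases n) auto
        define t where "t = a 2 / shift_coeff x (n - 1) 1"
        define a' where "a' = (\<lambda>i. a i - t * cobound_coeff x \<Delta> m i)"
        have h': "homogeneous_cocycle x \<Delta> n a' b"
          unfolding a'_def using h(1) homogeneous_cocycle_cobound_coeff [of x \<Delta> m] m by (intro homogeneous_cocycle_diff) auto
        have c: "cobound_coeff x \<Delta> m 2 = shift_coeff x (n - 1) 1" "cobound_coeff x \<Delta> m 3 = shift_coeff x (n - 1) 2"
          by (simp_all add: m cobound_coeff_def numeral_2_eq_2 numeral_3_eq_3)
        have a2: "a' 2 = 0"
          using k2 N1 \<open>w \<noteq> 0\<close> c by (simp add: a'_def t_def)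
        have "a' 3 = 0"
          using weight_seven_relation [OF h' h(2) n N_def 3 _ a2] True \<open>w \<noteq> 0\<close> by (simp add: w_def)
        then show ?thesis
          using a2 c 5 by (intro spanned_by_coboundary [of t]) (auto simp: a'_def)
      qed
    qed
  qed
qed

section \<open>Decomposition into homogeneous parts\<close>

text \<open>
  A polynomial \<open>f(\<partial>,\<lambda>)\<close> as a function of \<open>y = \<partial>+\<alpha>\<close> and \<open>l = \<lambda>\<close>, the variables in which the cocycle
  equations are homogeneous.
\<close>

definition eval_at :: "complex \<Rightarrow> complex poly poly \<Rightarrow> complex \<Rightarrow> complex \<Rightarrow> complex" where
  "eval_at \<alpha> f y l = poly (at_lam f l) (y - \<alpha>)"

lemma homogeneous_decomposition:
  "\<exists>A M. (\<forall>n i. n < i \<longrightarrow> A n i = 0) \<and> (\<forall>K\<ge>M. \<forall>y l. eval_at \<alpha> f y l = (\<Sum>n\<le>K. hform n (A n) y l))"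
proof -
  define q where "q i = pcompose (coeff f i) [:- \<alpha>, 1:]" for i
  define m where "m = Max ((\<lambda>i. degree (q i)) ` {..degree f})"
  define D where "D = degree f + m"
  define A where "A n i = (if i \<le> n then coeff (q i) (n - i) else 0)" for n i
  have q: "coeff (q i) k = 0" if "D < i + k" for i k
  proof (cases "i \<le> degree f")
    case True
    then have "degree (q i) \<le> m" unfolding m_def by (intro Max_ge) auto
    then show ?thesis using that True by (intro coeff_eq_0) (simp add: D_def)
  qed (simp add: q_def coeff_eq_0)
  have "eval_at \<alpha> f y l = (\<Sum>n\<le>K. hform n (A n) y l)" if K: "D \<le> K" for K y l
  proof -
    have "eval_at \<alpha> f y l = (\<Sum>i\<le>degree f. poly (q i) y * l ^ i)"
      by (simp add: eval_at_def poly_at_lam q_def poly_pcompose)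
    also have "\<dots> = (\<Sum>i\<le>K. poly (q i) y * l ^ i)"
      using K by (intro sum.mono_neutral_left) (auto simp: D_def q_def coeff_eq_0)
    also have "\<dots> = (\<Sum>i\<le>K. \<Sum>k\<le>K. coeff (q i) k * y ^ k * l ^ i)"
    proof (intro sum.cong refl)
      fix i
      have "degree (q i) \<le> K"
        using q [of i "degree (q i)"] K by (cases "q i = 0") (auto simp: not_less [symmetric])
      then have "poly (q i) y = (\<Sum>k\<le>K. coeff (q i) k * y ^ k)"
        unfolding poly_altdef by (intro sum.mono_neutral_left) (auto simp: coeff_eq_0)
      then show "poly (q i) y * l ^ i = (\<Sum>k\<le>K. coeff (q i) k * y ^ k * l ^ i)"
        by (simp add: sum_distrib_right)
    qed
    also have "\<dots> = (\<Sum>(i, k)\<in>{..K} \<times> {..K}. coeff (q i) k * y ^ k * l ^ i)"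
      by (simp add: sum.cartesian_product)
    also have "\<dots> = (\<Sum>(i, k)\<in>{(i, k). i + k \<le> K}. coeff (q i) k * y ^ k * l ^ i)"
    proof (intro sum.mono_neutral_right)
      have "coeff (q i) k = 0" if "\<not> i + k \<le> K" for i k using that K by (intro q) simp
      then show "\<forall>ik\<in>{..K} \<times> {..K} - {(i, k). i + k \<le> K}. (case ik of (i, k) \<Rightarrow> coeff (q i) k * y ^ k * l ^ i) = 0"
        by (auto, blast)
    qed auto
    also have "\<dots> = (\<Sum>n\<le>K. hform n (A n) y l)"
      by (simp add: sum.triangle_reindex_eq hform_def A_def)
    finally show ?thesis .
  qed
  moreover have "n < i \<longrightarrow> A n i = 0" for n i by (simp add: A_def)
  ultimately show ?thesis by blast
qed

lemma hform_scale: "hform n a (t * y) (t * l) = t ^ n * hform n a y l"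
proof -
  have "t ^ (n - i) * t ^ i = t ^ n" if "i \<le> n" for i
    using that by (simp add: power_add [symmetric])
  then show ?thesis unfolding hform_def sum_distrib_left
    by (intro sum.cong) (auto simp: power_mult_distrib mult_ac)
qed

lemma LL_defect_sum:
  "LL_defect x \<Delta> (\<lambda>y l. \<Sum>n\<le>(M::nat). F n y l) (\<lambda>y l. \<Sum>n\<le>M. G n y l) y l m
   = (\<Sum>n\<le>M. LL_defect x \<Delta> (F n) (G n) y l m)"
  by (induction M) (simp_all add: LL_defect_def algebra_simps)

lemma LI_defect_sum:
  "LI_defect x \<Delta> (\<lambda>y l. \<Sum>n\<le>(M::nat). G n y l) y l m = (\<Sum>n\<le>M. LI_defect x \<Delta> (G n) y l m)"
  by (induction M) (simp_all add: LI_defect_def algebra_simps)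

lemma LL_defect_scale:
  "LL_defect x \<Delta> (hform n a) (hform n b) (t * y) (t * l) (t * m)
   = t ^ Suc n * LL_defect x \<Delta> (hform n a) (hform n b) y l m"
  unfolding LL_defect_def distrib_left [symmetric] hform_scale by (simp add: algebra_simps)

lemma LI_defect_scale:
  "LI_defect x \<Delta> (hform n b) (t * y) (t * l) (t * m) = t ^ Suc n * LI_defect x \<Delta> (hform n b) y l m"
  unfolding LI_defect_def distrib_left [symmetric] hform_scale by (simp add: algebra_simps)

lemma power_sum_eq_0:
  fixes c :: "nat \<Rightarrow> complex"
  assumes "\<And>t. (\<Sum>n\<le>M. t ^ Suc n * c n) = 0" "n \<le> M"
  shows "c n = 0"
proof -
  define d where "d k = (case k of 0 \<Rightarrow> 0 | Suc k \<Rightarrow> c k)" for k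
  have "(\<Sum>k\<le>Suc M. d k * t ^ k) = 0" for t
    unfolding sum.atMost_Suc_shift using assms(1) [of t] by (simp add: d_def mult.commute)
  then have "d (Suc n) = 0" using assms(2) polyfun_eq_0 [of d "Suc M"] by auto
  then show ?thesis by (simp add: d_def)
qed

text \<open>
  Scaling \<open>y\<close>, \<open>l\<close>, \<open>m\<close> by \<open>t\<close> multiplies the part of degree \<open>n\<close> of a defect by \<open>t\<^sup>n\<^sup>+\<^sup>1\<close>, and a polynomial
  in \<open>t\<close> that vanishes identically has zero coefficients.
\<close>

lemma homogeneous_components:
  assumes A: "\<And>n i. n < i \<Longrightarrow> A n i = 0" and B: "\<And>n i. n < i \<Longrightarrow> B n i = 0"
    and LL: "\<And>y l m. LL_defect x \<Delta> (\<lambda>y l. \<Sum>n\<le>M. hform n (A n) y l) (\<lambda>y l. \<Sum>n\<le>M. hform n (B n) y l) y l m = 0"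
    and LI: "\<And>y l m. LI_defect x \<Delta> (\<lambda>y l. \<Sum>n\<le>M. hform n (B n) y l) y l m = 0"
    and n: "n \<le> M"
  shows "homogeneous_cocycle x \<Delta> n (A n) (B n)"
proof -
  have "LL_defect x \<Delta> (hform n (A n)) (hform n (B n)) y l m = 0" for y l m
  proof (rule power_sum_eq_0 [OF _ n])
    show "(\<Sum>n\<le>M. t ^ Suc n * LL_defect x \<Delta> (hform n (A n)) (hform n (B n)) y l m) = 0" for t
      using LL [of "t * y" "t * l" "t * m"] by (simp only: LL_defect_sum LL_defect_scale)
  qed
  moreover have "LI_defect x \<Delta> (hform n (B n)) y l m = 0" for y l m
  proof (rule power_sum_eq_0 [OF _ n])
    show "(\<Sum>n\<le>M. t ^ Suc n * LI_defect x \<Delta> (hform n (B n)) y l m) = 0" for t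
      using LI [of "t * y" "t * l" "t * m"] by (simp only: LI_defect_sum LI_defect_scale)
  qed
  ultimately show ?thesis using A B by (auto simp: homogeneous_cocycle_def)
qed

inductive subcritical_form :: "complex \<Rightarrow> nat \<Rightarrow> (complex \<Rightarrow> complex \<Rightarrow> complex) \<Rightarrow> (complex \<Rightarrow> complex \<Rightarrow> complex) \<Rightarrow> bool"
  for x n where
  "subcritical_form x n (\<lambda>_ _. 0) (\<lambda>_ _. 0)"
| "n = 0 \<Longrightarrow> subcritical_form x n (\<lambda>_ _. c) (\<lambda>_ _. 0)"
| "n = 1 \<Longrightarrow> c \<noteq> 0 \<Longrightarrow> subcritical_form x n (\<lambda>y l. c * y) (\<lambda>y l. c * x * l)"
| "n = 2 \<Longrightarrow> x = -1 \<Longrightarrow> c \<noteq> 0 \<Longrightarrow> subcritical_form x n (\<lambda>y l. c * (y^2 - l^2)) (\<lambda>y l. - c * (y + l) * l)"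

text \<open>
  By \<open>a0_nonzero_imp\<close> there is nothing but coboundaries when \<open>a 0 = 0\<close>, and otherwise \<open>n \<le> 2\<close>; the
  displayed forms are those of lemma \<open>subcritical\<close>.
\<close>

lemma subcritical_normal_form:
  assumes h: "homogeneous_cocycle x \<Delta> n a b" "x \<noteq> 0" and n: "of_nat n = \<Delta> - x"
  shows "\<exists>t P. (\<forall>y l. hform n a y l = coboundary x \<Delta> (\<lambda>y. t * y ^ (n - 1)) y l + P y l) \<and> subcritical_form x n P (hform n b)"
proof -
  define P where "P = hform n (\<lambda>i. if i = 0 then a 0 else of_nat (i - 1) * b i)"
  have D: "\<Delta> = x + of_nat n" using n by simp
  note b = b_eq [OF h]
  have "subcritical_form x n P (hform n b)"
  proof (cases "a 0 = 0")
    case True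
    then have "b = (\<lambda>_. 0)" by (rule b_eq_0 [OF h])
    moreover from this True have "P = (\<lambda>_ _. 0)"
      by (auto simp: P_def hform_def fun_eq_iff intro!: sum.neutral)
    ultimately show ?thesis using subcritical_form.intros(1) by (simp add: hform_zero)
  next
    case False
    have b0: "b 0 = 0" using b [of 0] D by (simp add: cobound_coeff_def shift_coeff_simps)
    have "n \<le> 2" and x: "n = 2 \<Longrightarrow> x = -1" using a0_nonzero_imp [OF h False] by auto
    then consider "n = 0" | "n = 1" | "n = 2" "x = -1" by linarith
    then show ?thesis
    proof cases
      case 1
      then have "P = (\<lambda>_ _. a 0)" "hform n b = (\<lambda>_ _. 0)" using b0 by (simp_all add: P_def hform_def fun_eq_iff)
      then show ?thesis using 1 False subcritical_form.intros(2) by simp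
    next
      case 2
      then have "P = (\<lambda>y l. a 0 * y)" "hform n b = (\<lambda>y l. a 0 * x * l)"
        using b0 b [of 1] by (simp_all add: P_def hform_def fun_eq_iff cobound_coeff_def shift_coeff_def)
      then show ?thesis using 2 False subcritical_form.intros(3) by simp
    next
      case 3
      then have "b 1 = - a 0" "b 2 = - a 0"
        using b [of 1] b [of 2] by (simp_all add: cobound_coeff_def shift_coeff_def eval_nat_numeral)
      then have "P = (\<lambda>y l. a 0 * (y^2 - l^2))" "hform n b = (\<lambda>y l. - a 0 * (y + l) * l)"
        using b0 3 by (simp_all add: P_def hform_def fun_eq_iff eval_nat_numeral algebra_simps)
      then show ?thesis using 3 False subcritical_form.intros(4) by simp
    qed
  qed
  then show ?thesis using subcritical [OF h n] unfolding P_def by blast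
qed

section \<open>Classification of cocycles\<close>

text \<open>
  The list of the theorem, as functions of \<open>y\<close> and \<open>l\<close>. A form of degree \<open>\<Delta> - \<Delta>'\<close> may occur together
  with one of degree \<open>\<Delta> - \<Delta>' + 1\<close>; this happens in \<open>affine\<close> and \<open>quadratic\<close>.
\<close>

inductive normal_cocycle ::
  "complex \<Rightarrow> complex \<Rightarrow> (complex \<Rightarrow> complex \<Rightarrow> complex) \<Rightarrow> (complex \<Rightarrow> complex \<Rightarrow> complex) \<Rightarrow> bool"
  for x \<Delta> where
  affine: "\<Delta> = x \<Longrightarrow> (c0, c1) \<noteq> (0, 0) \<Longrightarrow> normal_cocycle x \<Delta> (\<lambda>y l. c0 + c1 * l) (\<lambda>_ _. 0)"
| linear: "\<Delta> = x + 1 \<Longrightarrow> c \<noteq> 0 \<Longrightarrow> normal_cocycle x \<Delta> (\<lambda>y l. c * y) (\<lambda>y l. c * x * l)"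
| quadratic: "x = -1 \<Longrightarrow> \<Delta> = 1 \<Longrightarrow> c \<noteq> 0 \<Longrightarrow>
    normal_cocycle x \<Delta> (\<lambda>y l. c * (y^2 - l^2) + b * (l^2 * (2 * y + l))) (\<lambda>y l. - c * (y + l) * l)"
| critical: "critical_cochain x n c \<Longrightarrow> \<Delta> = x + of_nat n - 1 \<Longrightarrow> s \<noteq> 0 \<Longrightarrow>
    normal_cocycle x \<Delta> (\<lambda>y l. s * hform n c y l) (\<lambda>_ _. 0)"

text \<open>
  For \<open>k = 1\<close> the critical part is absent, as there is no critical cochain of degree 2; for \<open>k \<ge> 3\<close>
  the subcritical part is absent.
\<close>

lemma normal_cocycle_sum:
  assumes x: "x \<noteq> 0" and D: "\<Delta> = x + of_nat k"
    and s: "subcritical_form x k P G" and c: "critical_form x (Suc k) Q"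
  shows "(\<forall>y l. P y l + Q y l = 0 \<and> G y l = 0) \<or> normal_cocycle x \<Delta> (\<lambda>y l. P y l + Q y l) G"
  using s
proof cases
  case 1
  show ?thesis
    using c
  proof cases
    case 2
    then show ?thesis using D normal_cocycle.affine [of \<Delta> x 0] 1 by simp
  next
    case 3
    then show ?thesis using D normal_cocycle.critical [OF 3(2)] 1 by simp
  qed (simp add: 1)
next
  case (2 c0)
  obtain c1 where "Q = (\<lambda>y l. c1 * l)"
    using c
  proof cases
    case 1
    then show ?thesis using that [of 0] by simp
  next
    case 3
    from 3(2) 2(3) have False by cases auto
    then show ?thesis ..
  qed (use that in auto)
  then show ?thesis
    using normal_cocycle.affine [of \<Delta> x c0 c1] D 2 by (cases "(c0, c1) = (0, 0)") auto
next
  case (3 c0)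
  have "Q = (\<lambda>_ _. 0)"
    using c 3(3) by cases (auto elim: critical_cochain.cases)
  then show ?thesis
    using normal_cocycle.linear [of \<Delta> x c0] D 3 by simp
next
  case (4 c0)
  obtain b where "Q = (\<lambda>y l. b * (l^2 * (2 * y + l)))"
    using c
  proof cases
    case 1
    then show ?thesis using that [of 0] by simp
  next
    case 2
    then show ?thesis using 4(3) by simp
  next
    case (3 c s)
    have k: "Suc k = 3" using 4(3) by simp
    from 3(2) 4(3) have c: "c = nth_default 0 [0, 0, 2, 1]" by cases auto
    have "hform (Suc k) c = (\<lambda>y l. l^2 * (2 * y + l))"
      unfolding k c fun_eq_iff hform_nth_default by (simp add: eval_nat_numeral algebra_simps)
    then show ?thesis using that [of s] 3(1) by simp
  qed
  then show ?thesis
    using normal_cocycle.quadratic [of x \<Delta> c0 b] D 4 by simp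
qed

lemma coboundary_sum:
  "coboundary x \<Delta> (\<lambda>y. \<Sum>n\<le>(K::nat). \<phi> n y) y l = (\<Sum>n\<le>K. coboundary x \<Delta> (\<phi> n) y l)"
  by (simp add: coboundary_def sum_distrib_left sum_subtractf)

text \<open>
  All homogeneous parts except those of degrees \<open>\<Delta> - \<Delta>'\<close> and \<open>\<Delta> - \<Delta>' + 1\<close> are coboundaries. These
  degrees are \<open>k\<close> and \<open>k + 1\<close> if \<open>\<Delta> - \<Delta>'\<close> is a natural number \<open>k\<close>. Otherwise only degree 0 can be
  critical, where nothing nonzero exists.
\<close>

theorem cocycle_classification:
  assumes x: "x \<noteq> 0"
    and LL: "\<And>y l m. LL_defect x \<Delta> (eval_at \<alpha> f) (eval_at \<alpha> g) y l m = 0"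
    and LI: "\<And>y l m. LI_defect x \<Delta> (eval_at \<alpha> g) y l m = 0"
  shows "\<exists>\<phi> P. (\<forall>y l. eval_at \<alpha> f y l = coboundary x \<Delta> (poly \<phi>) y l + P y l)
    \<and> ((\<forall>y l. P y l = 0 \<and> eval_at \<alpha> g y l = 0) \<or> normal_cocycle x \<Delta> P (eval_at \<alpha> g))"
proof -
  from homogeneous_decomposition [where f = f and \<alpha> = \<alpha>] obtain A M where A': "\<forall>n i. n < i \<longrightarrow> A n i = 0"
    and f': "\<forall>K\<ge>M. \<forall>y l. eval_at \<alpha> f y l = (\<Sum>n\<le>K. hform n (A n) y l)"
    by (elim exE conjE)
  from homogeneous_decomposition [where f = g and \<alpha> = \<alpha>] obtain B M' where B': "\<forall>n i. n < i \<longrightarrow> B n i = 0"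
    and g': "\<forall>K\<ge>M'. \<forall>y l. eval_at \<alpha> g y l = (\<Sum>n\<le>K. hform n (B n) y l)"
    by (elim exE conjE)
  note A = A' [rule_format] and B = B' [rule_format]
    and f = f' [rule_format] and g = g' [rule_format]
  have h: "homogeneous_cocycle x \<Delta> n (A n) (B n)" for n
  proof -
    define K where "K = max n (max M M')"
    have K: "M \<le> K" "M' \<le> K" "n \<le> K" by (simp_all add: K_def)
    have fK: "eval_at \<alpha> f = (\<lambda>y l. \<Sum>n\<le>K. hform n (A n) y l)"
      and gK: "eval_at \<alpha> g = (\<lambda>y l. \<Sum>n\<le>K. hform n (B n) y l)"
      using f [OF K(1)] g [OF K(2)] by (simp_all add: fun_eq_iff)
    show ?thesis
      by (rule homogeneous_components [OF A B _ _ K(3)])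
        (assumption, assumption, rule LL [unfolded fK gK], rule LI [unfolded gK])
  qed
  define part where "part n P \<longleftrightarrow>
      (of_nat n = \<Delta> - x \<longrightarrow> subcritical_form x n P (hform n (B n)))
    \<and> (of_nat n = \<Delta> - x + 1 \<longrightarrow> critical_form x n P \<and> hform n (B n) = (\<lambda>_ _. 0))
    \<and> (of_nat n \<noteq> \<Delta> - x \<longrightarrow> of_nat n \<noteq> \<Delta> - x + 1 \<longrightarrow> P = (\<lambda>_ _. 0) \<and> hform n (B n) = (\<lambda>_ _. 0))" for n P
  have "\<forall>n. \<exists>t P. (\<forall>y l. hform n (A n) y l = coboundary x \<Delta> (\<lambda>y. t * y ^ (n - 1)) y l + P y l) \<and> part n P"
  proof
    fix n
    consider "of_nat n = \<Delta> - x" | "of_nat n = \<Delta> - x + 1" | "of_nat n \<noteq> \<Delta> - x" "of_nat n \<noteq> \<Delta> - x + 1" by blast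
    then show "\<exists>t P. (\<forall>y l. hform n (A n) y l = coboundary x \<Delta> (\<lambda>y. t * y ^ (n - 1)) y l + P y l) \<and> part n P"
    proof cases
      case 1
      then show ?thesis using subcritical_normal_form [OF h x 1] by (simp add: part_def)
    next
      case 2
      then show ?thesis using critical_normal_form [OF h x 2] critical_low_coefficients(2) [OF h x 2]
        by (simp add: part_def hform_zero)
    next
      case 3
      obtain t where "\<forall>y l. hform n (A n) y l = coboundary x \<Delta> (\<lambda>y. t * y ^ (n - 1)) y l"
        using noncritical(2) [OF h x 3] by blast
      moreover have "part n (\<lambda>_ _. 0)"
        using 3 noncritical(1) [OF h x 3] by (simp add: part_def hform_zero)
      ultimately show ?thesis by (intro exI [of _ t] exI [of _ "\<lambda>_ _. 0"]) simp
    qed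
  qed
  from choice [OF this] obtain t where
    "\<forall>n. \<exists>P. (\<forall>y l. hform n (A n) y l = coboundary x \<Delta> (\<lambda>y. t n * y ^ (n - 1)) y l + P y l) \<and> part n P"
    by blast
  from choice [OF this] obtain P where P: "\<And>n y l. hform n (A n) y l = coboundary x \<Delta> (\<lambda>y. t n * y ^ (n - 1)) y l + P n y l"
      "\<And>n. part n (P n)"
    by blast
  define \<phi> where "\<phi> K = (\<Sum>n\<le>K. monom (t n) (n - 1))" for K
  have fK: "eval_at \<alpha> f y l = coboundary x \<Delta> (poly (\<phi> K)) y l + (\<Sum>n\<le>K. P n y l)"
    if "M \<le> K" for K y l
  proof -
    have "poly (\<phi> K) = (\<lambda>y. \<Sum>n\<le>K. t n * y ^ (n - 1))"
      by (simp add: \<phi>_def poly_sum poly_monom fun_eq_iff)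
    then show ?thesis unfolding f [OF that] P(1) by (simp add: coboundary_sum sum.distrib)
  qed
  show ?thesis
  proof (cases "\<exists>k. of_nat k = \<Delta> - x")
    case True
    then obtain k where k: "of_nat k = \<Delta> - x" by blast
    then have k': "of_nat (Suc k) = \<Delta> - x + 1" by simp
    define K where "K = max (Suc k) (max M M')"
    have *: "of_nat n \<noteq> \<Delta> - x" "of_nat n \<noteq> \<Delta> - x + 1" if "n \<noteq> k" "n \<noteq> Suc k" for n
      using that of_nat_eq_iff [of n k, where 'a = complex] of_nat_eq_iff [of n "Suc k", where 'a = complex]
      unfolding k k' by simp_all
    have z: "P n y l = 0" "hform n (B n) y l = 0" if "n \<noteq> k" "n \<noteq> Suc k" for n y l
      using P(2) [of n] * [OF that] by (simp_all add: part_def)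
    have zB: "hform (Suc k) (B (Suc k)) = (\<lambda>_ _. 0)"
      using P(2) [of "Suc k"] k' unfolding part_def by metis
    have s: "(\<Sum>n\<le>K. P n y l) = (\<Sum>n\<in>{k, Suc k}. P n y l)"
      "(\<Sum>n\<le>K. hform n (B n) y l) = (\<Sum>n\<in>{k, Suc k}. hform n (B n) y l)" for y l
      by (rule sum.mono_neutral_right; auto simp: K_def z)+
    have "subcritical_form x k (P k) (hform k (B k))"
      using P(2) [of k] k unfolding part_def by metis
    moreover have "critical_form x (Suc k) (P (Suc k))"
      using P(2) [of "Suc k"] k' unfolding part_def by metis
    moreover have "\<Delta> = x + of_nat k" using k by simp
    ultimately have *: "(\<forall>y l. P k y l + P (Suc k) y l = 0 \<and> hform k (B k) y l = 0)
        \<or> normal_cocycle x \<Delta> (\<lambda>y l. P k y l + P (Suc k) y l) (hform k (B k))"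
      using x by (intro normal_cocycle_sum)
    have f2: "eval_at \<alpha> f y l = coboundary x \<Delta> (poly (\<phi> K)) y l + (P k y l + P (Suc k) y l)" for y l
    proof -
      have "M \<le> K" by (simp add: K_def)
      from fK [OF this, of y l] show ?thesis unfolding s(1) by simp
    qed
    have g2: "eval_at \<alpha> g = hform k (B k)"
    proof (intro ext)
      fix y l
      have "M' \<le> K" by (simp add: K_def)
      from g [OF this, of y l] show "eval_at \<alpha> g y l = hform k (B k) y l"
        unfolding s(2) by (simp add: zB)
    qed
    show ?thesis
      by (rule exI [of _ "\<phi> K"], rule exI [of _ "\<lambda>y l. P k y l + P (Suc k) y l"], intro conjI allI)
        (rule f2, unfold g2, rule *)
  next
    case False
    then have no: "of_nat n \<noteq> \<Delta> - x" for n by metis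
    have z: "P n = (\<lambda>_ _. 0) \<and> hform n (B n) = (\<lambda>_ _. 0)" for n
    proof (cases "of_nat n = \<Delta> - x + 1")
      case True
      then have n: "n = 0" using no [of "n - 1"] by (cases n) auto
      have c: "critical_form x n (P n)" and "hform n (B n) = (\<lambda>_ _. 0)"
        using P(2) [of n] True unfolding part_def by metis+
      moreover from c have "P n = (\<lambda>_ _. 0)"
      proof cases
        case 3
        from 3(2) n have False by cases auto
        then show ?thesis ..
      qed (use n in simp_all)
      ultimately show ?thesis by simp
    next
      case False
      then show ?thesis using P(2) [of n] no [of n] unfolding part_def by metis
    qed
    have "eval_at \<alpha> f y l = coboundary x \<Delta> (poly (\<phi> M)) y l + 0" "eval_at \<alpha> g y l = 0" for y l
      using fK [of M y l] g [of M' y l] by (simp_all only: z order_refl sum.neutral_const)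
    then show ?thesis
      by (intro exI [of _ "\<phi> M"] exI [of _ "\<lambda>_ _. 0"]) auto
  qed
qed

text \<open>
  A form of degree \<open>n\<close> that is a coboundary is already one of the monomial of degree \<open>n - 1\<close>, by
  comparison of the parts of degree \<open>n\<close>.
\<close>

lemma coboundary_homogeneous:
  assumes "\<And>y l. coboundary x \<Delta> (poly \<phi>) y l = hform n c y l" "i \<le> n" "0 < n"
  shows "c i = coeff \<phi> (n - 1) * cobound_coeff x \<Delta> (n - 1) i"
proof -
  define M where "M = max n (degree \<phi>)"
  \<comment> \<open>the parts of degree \<open>k + 1\<close> of the difference of both sides\<close>
  define d where "d k y l = coeff \<phi> k * hform (Suc k) (cobound_coeff x \<Delta> k) y l - (if Suc k = n then hform n c y l else 0)" for k y l
  have M: "n \<le> M" "degree \<phi> \<le> M" by (simp_all add: M_def)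
  have hform_smult: "hform m (\<lambda>i. t * a i) y l = t * hform m a y l" for m t a y l
    by (simp add: hform_def sum_distrib_left mult_ac)
  have e: "coboundary x \<Delta> (poly \<phi>) y l = (\<Sum>k\<le>M. coeff \<phi> k * hform (Suc k) (cobound_coeff x \<Delta> k) y l)" for y l
  proof -
    have "poly \<phi> = (\<lambda>y. \<Sum>k\<le>M. coeff \<phi> k * y ^ k)"
      unfolding poly_altdef [abs_def] using M(2)
      by (intro ext sum.mono_neutral_left) (auto simp: coeff_eq_0)
    then show ?thesis by (simp add: coboundary_sum hform_cobound_coeff [symmetric] hform_smult)
  qed
  have "d (n - 1) 1 l = 0" for l
  proof (rule power_sum_eq_0 [where c = "\<lambda>k. d k 1 l" and M = M])
    show "(\<Sum>k\<le>M. t ^ Suc k * d k 1 l) = 0" for t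
    proof -
      have "(\<Sum>k\<le>M. t ^ Suc k * d k 1 l)
        = (\<Sum>k\<le>M. coeff \<phi> k * hform (Suc k) (cobound_coeff x \<Delta> k) (t * 1) (t * l))
          - (\<Sum>k\<le>M. if k = n - 1 then t ^ n * hform n c 1 l else 0)"
        unfolding sum_subtractf [symmetric] d_def hform_scale
        using assms(3) by (intro sum.cong) (auto simp: algebra_simps)
      also have "\<dots> = coboundary x \<Delta> (poly \<phi>) (t * 1) (t * l) - hform n c (t * 1) (t * l)"
        unfolding e hform_scale using M(1) by simp
      finally show ?thesis using assms(1) by simp
    qed
  qed (use M(1) in simp)
  then have "(\<Sum>i\<le>n. (coeff \<phi> (n - 1) * cobound_coeff x \<Delta> (n - 1) i - c i) * l ^ i) = 0" for l
    using assms(3) by (simp add: d_def hform_def sum_distrib_left sum_subtractf algebra_simps)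
  then show ?thesis
    using polyfun_eq_0 [of "\<lambda>i. coeff \<phi> (n - 1) * cobound_coeff x \<Delta> (n - 1) i - c i" n] assms(2) by simp
qed

lemma normal_cocycle_not_coboundary:
  assumes "normal_cocycle x \<Delta> F G" "x \<noteq> 0"
    and F: "\<And>y l. F y l = coboundary x \<Delta> (poly \<phi>) y l" and G: "\<And>y l. G y l = 0"
  shows False
  using assms(1)
proof cases
  case (affine c0 c1)
  have "c0 = 0" using F [of 0 0] by (simp add: affine coboundary_def)
  then have "coboundary x \<Delta> (poly \<phi>) y l = hform 1 (nth_default 0 [0, c1]) y l" for y l
    using F [of y l] by (simp add: affine hform_def nth_default_def)
  from coboundary_homogeneous [OF this, of 1] have "c1 = 0"
    by (simp add: affine cobound_coeff_def shift_coeff_simps nth_default_def)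
  then show False using affine \<open>c0 = 0\<close> by simp
next
  case (linear c)
  then show False using G [of 0 1] assms(2) by simp
next
  case (quadratic c b)
  then show False using G [of 0 1] by simp
next
  case (critical n c s)
  have n: "3 \<le> n" using critical(3) by cases auto
  have "coboundary x \<Delta> (poly \<phi>) y l = hform n (\<lambda>i. s * c i) y l" for y l
    using F [of y l] by (simp add: critical hform_def sum_distrib_left mult_ac)
  from coboundary_homogeneous [OF this, of 2] coboundary_homogeneous [OF this, of 3]
  have "s * c 2 = coeff \<phi> (n - 1) * shift_coeff x (n - 1) 1" "s * c 3 = coeff \<phi> (n - 1) * shift_coeff x (n - 1) 2"
    using n by (simp_all add: cobound_coeff_def numeral_2_eq_2 numeral_3_eq_3)
  then have "s * (shift_coeff x (n - 1) 1 * c 3 - shift_coeff x (n - 1) 2 * c 2) = 0"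
    by algebra
  then show False using critical critical_cochain_det by simp
qed

lemma normal_cocycle_defects:
  assumes "normal_cocycle x \<Delta> F G"
  shows "LL_defect x \<Delta> F G y l m = 0" and "LI_defect x \<Delta> G y l m = 0"
  using assms
proof (induction)
  case (critical n c s)
  {
    case 1
    have "LL_defect x \<Delta> (\<lambda>y l. s * hform n c y l) (\<lambda>_ _. 0) y l m
      = s * LL_defect x \<Delta> (hform n c) (hform n (\<lambda>_. 0)) y l m"
      by (simp add: LL_defect_def hform_zero algebra_simps)
    then show ?case
      using homogeneous_cocycle_critical_cochain [OF critical(1)] critical(2) by (simp add: homogeneous_cocycle_def)
  }
qed (simp_all add: LL_defect_def LI_defect_def power2_eq_square algebra_simps)

section \<open>Cocycles and the list\<close>

lemma at_lam_simps:
  "at_lam (p + q) l = at_lam p l + at_lam q l" "at_lam (p - q) l = at_lam p l - at_lam q l"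
  "at_lam (p * q) l = at_lam p l * at_lam q l" "at_lam (p ^ k) l = at_lam p l ^ k"
  "at_lam (numeral w) l = numeral w" "at_lam 0 l = 0"
  "at_lam [:r:] l = r" "at_lam Lam l = [:l:]"
  by (simp_all add: at_lam_def)

lemma eval_at_simps:
  "eval_at \<alpha> (p + q) y l = eval_at \<alpha> p y l + eval_at \<alpha> q y l"
  "eval_at \<alpha> (p - q) y l = eval_at \<alpha> p y l - eval_at \<alpha> q y l"
  "eval_at \<alpha> (p * q) y l = eval_at \<alpha> p y l * eval_at \<alpha> q y l"
  "eval_at \<alpha> (p ^ k) y l = eval_at \<alpha> p y l ^ k"
  "eval_at \<alpha> (numeral w) y l = numeral w" "eval_at \<alpha> 0 y l = 0"
  "eval_at \<alpha> (cst c) y l = c" "eval_at \<alpha> (Dbar \<alpha>) y l = y" "eval_at \<alpha> Lam y l = l"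
  by (simp_all add: eval_at_def at_lam_simps)

lemma quadratic_roots_7:
  fixes x :: complex
  assumes "x^2 + 5 * x + 3/2 = 0"
  shows "x = - 5/2 + of_real (sqrt 19) / 2 \<or> x = - 5/2 - of_real (sqrt 19) / 2"
proof -
  define s :: complex where "s = of_real (sqrt 19)"
  have s: "s * s = 19" by (simp add: s_def flip: of_real_mult)
  have "(x - (- 5/2 + s / 2)) * (x - (- 5/2 - s / 2)) = x^2 + 5 * x + (25 - s * s) / 4"
    by (simp add: field_simps power2_eq_square)
  also have "\<dots> = 0" using assms by (simp add: s)
  finally show ?thesis unfolding s_def mult_eq_0_iff by (simp only: right_minus_eq)
qed

text \<open>
  All entries with \<open>g = 0\<close> and \<open>\<Delta> \<noteq> \<Delta>'\<close> are multiples of critical cochains; the square root in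
  \<open>listed.vii\<close> becomes a quadratic equation for \<open>\<Delta>'\<close>.
\<close>

lemma normal_cocycle_of_listed:
  assumes "listed \<alpha> x \<Delta> f g" "x \<noteq> 0"
  shows "normal_cocycle x \<Delta> (eval_at \<alpha> f) (eval_at \<alpha> g)"
proof -
  have crit: ?thesis
    if "critical_cochain x n c" "\<Delta> = x + of_nat n - 1" "b \<noteq> 0" "g = 0"
      and "\<And>y l. eval_at \<alpha> f y l = b * hform n c y l" for n c b
  proof -
    have "eval_at \<alpha> f = (\<lambda>y l. b * hform n c y l)" "eval_at \<alpha> g = (\<lambda>_ _. 0)"
      using that by (simp_all add: fun_eq_iff eval_at_simps)
    then show ?thesis using normal_cocycle.critical [OF that(1-3)] by simp
  qed
  from assms(1) show ?thesis
  proof cases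
    case (i c0 c1)
    have "eval_at \<alpha> f = (\<lambda>y l. c0 + c1 * l)" "eval_at \<alpha> g = (\<lambda>_ _. 0)"
      unfolding i fun_eq_iff eval_at_simps by simp_all
    then show ?thesis using normal_cocycle.affine i by simp
  next
    case (ii a1)
    have "eval_at \<alpha> f = (\<lambda>y l. (a1 / x) * y)" "eval_at \<alpha> g = (\<lambda>y l. a1 / x * x * l)"
      unfolding ii fun_eq_iff eval_at_simps using assms(2) by simp_all
    then show ?thesis
      using normal_cocycle.linear [of \<Delta> x "a1 / x"] ii assms(2) by (simp add: algebra_simps)
  next
    case (iii b1)
    show ?thesis
    proof (rule crit [OF critical_cochain.intros(1) _ iii(4,2)])
      show "\<Delta> = x + of_nat 3 - 1" using iii by (simp add: algebra_simps)
    qed (simp only: iii eval_at_simps hform_nth_default, simp add: power3_eq_cube power2_eq_square algebra_simps)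
  next
    case (iii' a1 b)
    have "eval_at \<alpha> f = (\<lambda>y l. (- a1) * (y^2 - l^2) + b * (l^2 * (2 * y + l)))"
      "eval_at \<alpha> g = (\<lambda>y l. - (- a1) * (y + l) * l)"
      unfolding iii' fun_eq_iff eval_at_simps by (simp_all add: algebra_simps)
    then show ?thesis using normal_cocycle.quadratic [of x \<Delta> "- a1" b] iii' by simp
  next
    case (iv b1)
    show ?thesis
    proof (rule crit [OF critical_cochain.intros(2) _ iv(4,2)])
      show "\<Delta> = x + of_nat 4 - 1" using iv by (simp add: algebra_simps)
    qed (simp only: iv eval_at_simps hform_nth_default, simp add: eval_nat_numeral algebra_simps)
  next
    case (v b1)
    show ?thesis
    proof (rule crit [OF critical_cochain.intros(3) _ v(4,2)])
      show "\<Delta> = x + of_nat 5 - 1" using v by (simp add: algebra_simps)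
    qed (simp only: v eval_at_simps hform_nth_default, simp add: eval_nat_numeral algebra_simps)
  next
    case (vi b1)
    show ?thesis
    proof (rule crit [OF critical_cochain.intros(4) [OF vi(2)] _ vi(5,3)])
      show "\<Delta> = x + of_nat 6 - 1" using vi by simp
    qed (simp only: vi eval_at_simps hform_nth_default, simp add: eval_nat_numeral algebra_simps)
  next
    case (vii b1)
    define s :: complex where "s = of_real (sqrt 19)"
    have s: "s * s = 19" by (simp add: s_def flip: of_real_mult)
    have "x + 5/2 = s / 2 \<or> x + 5/2 = - (s / 2)" using vii(1) by (auto simp: s_def)
    then have "(x + 5/2)^2 = (s / 2)^2" by (simp only: power2_eq_iff)
    then have "(x + 5/2)^2 = 19 / 4" using s by (simp add: power2_eq_square)
    moreover have "x^2 + 5 * x + 3/2 = (x + 5/2)^2 - 19 / 4"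
      by (simp add: power2_eq_square field_simps)
    ultimately have q: "x^2 + 5 * x + 3/2 = 0" by simp
    show ?thesis
    proof (rule crit [OF critical_cochain.intros(5) [OF q] _ vii(4,2)])
      show "\<Delta> = x + of_nat 7 - 1" using vii(1) by auto
    qed (simp only: vii eval_at_simps hform_nth_default, simp add: eval_nat_numeral algebra_simps)
  qed
qed

lemma listed_of_normal_cocycle:
  assumes "normal_cocycle x \<Delta> F G" "x \<noteq> 0"
  shows "\<exists>f g. listed \<alpha> x \<Delta> f g \<and> F = eval_at \<alpha> f \<and> G = eval_at \<alpha> g"
  using assms(1)
proof cases
  case (affine c0 c1)
  have "listed \<alpha> x \<Delta> (cst c0 + cst c1 * Lam) 0" using affine listed.i by blast
  moreover have "F = eval_at \<alpha> (cst c0 + cst c1 * Lam)" "G = eval_at \<alpha> 0"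
    unfolding affine fun_eq_iff eval_at_simps by simp_all
  ultimately show ?thesis by blast
next
  case (linear c)
  have "listed \<alpha> x \<Delta> (cst (c * x / x) * Dbar \<alpha>) (cst (c * x) * Lam)"
    using linear assms(2) by (intro listed.ii [OF _ refl refl]) simp_all
  moreover have "F = eval_at \<alpha> (cst (c * x / x) * Dbar \<alpha>)" "G = eval_at \<alpha> (cst (c * x) * Lam)"
    unfolding linear fun_eq_iff eval_at_simps using assms(2) by simp_all
  ultimately show ?thesis by blast
next
  case (quadratic c b)
  let ?f = "cst (- c) * (Lam\<^sup>2 - (Dbar \<alpha>)\<^sup>2) + cst b * (2 * Dbar \<alpha> + Lam) * Lam\<^sup>2"
    and ?g = "cst (- c) * (Dbar \<alpha> + Lam) * Lam"
  have "listed \<alpha> x \<Delta> ?f ?g"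
    using quadratic by (intro listed.iii' [OF _ _ refl refl]) simp_all
  moreover have "F = eval_at \<alpha> ?f" "G = eval_at \<alpha> ?g"
    unfolding quadratic fun_eq_iff eval_at_simps by (simp_all add: algebra_simps)
  ultimately show ?thesis by blast
next
  case (critical n c s)
  have *: ?thesis
    if "listed \<alpha> x \<Delta> f 0" "\<And>y l. s * hform n c y l = eval_at \<alpha> f y l" for f
    using that critical(1,2) by (intro exI [of _ f] exI [of _ 0]) (simp add: fun_eq_iff eval_at_simps)
  from critical(3) show ?thesis
  proof cases
    case 1
    show ?thesis
      by (rule * [OF listed.iii [OF _ refl refl critical(5)]])
        (use 1 critical(4) in simp, simp only: 1 eval_at_simps hform_nth_default,
          simp add: eval_nat_numeral algebra_simps)
  next
    case 2
    show ?thesis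
      by (rule * [OF listed.iv [OF _ refl refl critical(5)]])
        (use 2 critical(4) in simp, simp only: 2 eval_at_simps hform_nth_default,
          simp add: eval_nat_numeral algebra_simps)
  next
    case 3
    show ?thesis
      by (rule * [OF listed.v [OF _ refl refl critical(5)]])
        (use 3 critical(4) in simp, simp only: 3 eval_at_simps hform_nth_default,
          simp add: eval_nat_numeral algebra_simps)
  next
    case 4
    show ?thesis
      by (rule * [OF listed.vi [OF _ 4(3) refl refl critical(5)]])
        (use 4 critical(4) in simp, simp only: 4 eval_at_simps hform_nth_default,
          simp add: eval_nat_numeral algebra_simps)
  next
    case 5
    have "(\<Delta> = 7/2 + of_real (sqrt 19) / 2 \<and> x = - 5/2 + of_real (sqrt 19) / 2)
        \<or> (\<Delta> = 7/2 - of_real (sqrt 19) / 2 \<and> x = - 5/2 - of_real (sqrt 19) / 2)"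
      using quadratic_roots_7 [OF 5(3)] by (auto simp: critical(4) 5)
    from listed.vii [OF this refl refl critical(5)] show ?thesis
      by (rule *) (simp only: 5 eval_at_simps hform_nth_default, simp add: eval_nat_numeral algebra_simps)
  qed
qed

section \<open>Conformal modules\<close>

lemma poly_eqI: "(\<And>z. poly p z = poly q z) \<Longrightarrow> p = (q :: complex poly)"
  by (simp add: poly_eq_poly_eq_iff [symmetric] fun_eq_iff)

lemma lca_decompose: "a = lca_scale (fst a) genL + lca_scale (snd a) genI"
  by (simp add: lca_scale_def genL_def genI_def)

lemma pshift_pCons: "pshift l (pCons c p) = [:c:] + [:l, 1:] * pshift l p"
  by (simp add: pshift_def pcompose_pCons)

lemma pneg_pCons: "pneg l (pCons c p) = [:c:] - [:l:] * pneg l p"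
  by (simp add: pneg_def)

locale conformal =
  fixes E :: "'e::ab_group_add cmod"
  assumes conformal: "conformal_module E"
begin

sublocale module "scl E"
  using conformal by (simp add: conformal_module_def)

lemma act_add: "act E a l (v + w) = act E a l v + act E a l w"
  and act_const: "act E a l (scl E [:c:] v) = scl E [:c:] (act E a l v)"
  and act_polynomial: "polynomial_family (scl E) (\<lambda>l. act E a l v)"
  and act_add_left: "act E (a + b) l v = act E a l v + act E b l v"
  and act_const_left: "act E (lca_scale [:c:] a) l v = scl E [:c:] (act E a l v)"
  and act_bracket: "act E a l (act E b m v) - act E b m (act E a l v) = act E (lca_bracket a l b) (l + m) v"
  and act_D: "act E (lca_scale Dpoly a) l v = scl E Dpoly (act E a l v) - act E a l (scl E Dpoly v)"
  and act_D_left: "act E (lca_scale Dpoly a) l v = - scl E [:l:] (act E a l v)"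
  using conformal unfolding conformal_module_def by metis+

lemma act_zero [simp]: "act E a l 0 = 0"
  using act_const [of a l 0 0] by simp

text \<open>
  By induction from \<open>a\<^sub>\<lambda>(\<partial>v) = (\<partial>+\<lambda>)a\<^sub>\<lambda>v\<close>. With \<open>act_scale\<close>, it reduces the action to that of \<open>L\<close> and
  \<open>I\<close> on generators of the module.
\<close>

lemma act_scl: "act E a l (scl E p v) = scl E (pshift l p) (act E a l v)"
proof (induction p)
  case 0
  then show ?case by (simp add: pshift_def)
next
  case (pCons c p)
  have D: "act E a l (scl E Dpoly w) = scl E [:l, 1:] (act E a l w)" for w
  proof -
    have "act E a l (scl E Dpoly w) = scl E Dpoly (act E a l w) + scl E [:l:] (act E a l w)"
      using act_D [of a l w] act_D_left [of a l w] by (simp add: algebra_simps)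
    then show ?thesis by (simp add: scale_left_distrib [symmetric])
  qed
  have e: "scl E (pCons c p) v = scl E [:c:] v + scl E Dpoly (scl E p v)"
    by (simp add: scale_left_distrib [symmetric])
  show ?case
    by (simp only: e act_add act_const D pCons.IH pshift_pCons scale_left_distrib) (simp only: scale_scale)
qed

lemma act_scale: "act E (lca_scale p a) l v = scl E (pneg l p) (act E a l v)"
proof (induction p)
  case 0
  have "lca_scale 0 a = lca_scale [:0:] a" by simp
  then show ?case using act_const_left [of 0 a l v] by (simp add: pneg_def)
next
  case (pCons c p)
  have "lca_scale (pCons c p) a = lca_scale [:c:] a + lca_scale Dpoly (lca_scale p a)"
    by (simp add: lca_scale_def algebra_simps smult_add_left)
  then show ?case
    by (simp only: act_add_left act_const_left act_D_left pCons.IH pneg_pCons scale_left_diff_distrib scale_scale)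
      simp
qed

lemma act_generators:
  "act E a l v = scl E (pneg l (fst a)) (act E genL l v) + scl E (pneg l (snd a)) (act E genI l v)"
  by (subst lca_decompose [of a]) (simp only: act_add_left act_scale)

end

section \<open>Extensions and their cocycles\<close>

locale extension =
  fixes \<alpha>' \<Delta>' \<alpha> \<Delta> :: complex
    and E :: "'e::ab_group_add cmod" and \<iota> \<pi>
  assumes ext: "is_extension (Vmod \<alpha>' \<Delta>') (Vmod \<alpha> \<Delta>) E \<iota> \<pi>"
begin

sublocale conformal E
  using ext by unfold_locales (simp add: is_extension_def)

lemma Vmod_act:
  "act (Vmod \<alpha> \<Delta>) a l q = pneg l (fst a) * pshift l q * [:\<alpha> + \<Delta> * l, 1:]"
  by (simp add: Vmod_def)

lemma Vmod_scl: "scl (Vmod a d) = (*)"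
  by (simp add: Vmod_def)

lemma iota_hom: "\<iota> (p + q) = \<iota> p + \<iota> q" "\<iota> (p * q) = scl E p (\<iota> q)"
    "\<iota> (act (Vmod \<alpha>' \<Delta>') a l q) = act E a l (\<iota> q)"
  and pi_hom: "\<pi> (e + e') = \<pi> e + \<pi> e'" "\<pi> (scl E p e) = p * \<pi> e"
    "\<pi> (act E a l e) = act (Vmod \<alpha> \<Delta>) a l (\<pi> e)"
  and inj_iota: "inj \<iota>" and range_iota: "range \<iota> = {e. \<pi> e = 0}" and surj_pi: "surj \<pi>"
  using ext by (auto simp: is_extension_def cmod_hom_def module_hom_def module_hom_axioms_def Vmod_scl
      simp del: split_paired_All)

lemma pi_iota [simp]: "\<pi> (\<iota> q) = 0"
  using range_iota by blast

lemma iota_zero [simp]: "\<iota> 0 = 0" and iota_minus: "\<iota> (- q) = - \<iota> q" and iota_diff: "\<iota> (p - q) = \<iota> p - \<iota> q"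
  and pi_diff: "\<pi> (e - e') = \<pi> e - \<pi> e'"
proof -
  show z: "\<iota> 0 = 0" using iota_hom(1) [of 0 0] by simp
  show m: "\<iota> (- q) = - \<iota> q" for q using iota_hom(1) [of q "- q"] z by (simp add: eq_neg_iff_add_eq_0 add.commute)
  show "\<iota> (p - q) = \<iota> p - \<iota> q" using iota_hom(1) [of p "- q"] m by simp
  show "\<pi> (e - e') = \<pi> e - \<pi> e'" using pi_hom(1) [of "e - e'" e'] by simp
qed

lemma decompose:
  assumes "\<pi> v = 1"
  shows "\<exists>q. e = scl E (\<pi> e) v + \<iota> q"
proof -
  have "\<pi> (e - scl E (\<pi> e) v) = 0" using assms by (simp add: pi_diff pi_hom)
  then obtain q where "e - scl E (\<pi> e) v = \<iota> q" using range_iota by blast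
  then have "e = scl E (\<pi> e) v + \<iota> q" by (simp add: algebra_simps)
  then show ?thesis ..
qed

lemma decompose_unique:
  assumes "\<pi> v = 1" and eq: "scl E p v + \<iota> q = scl E p' v + \<iota> q'"
  shows "p = p'" and "q = q'"
proof -
  from arg_cong [OF eq, of \<pi>] show p: "p = p'" using assms(1) by (simp add: pi_hom)
  then show "q = q'" using eq inj_iota by (simp add: inj_eq)
qed

lemma iota_sum: "\<iota> (sum f A) = (\<Sum>i\<in>A. \<iota> (f i))"
  by (induction A rule: infinite_finite_induct) (simp_all add: iota_hom)

text \<open>
  The family \<open>a\<^sub>\<lambda>v\<close> is polynomial in \<open>E\<close>; splitting its coefficients along \<open>v\<close> shows that its component in
  the submodule is polynomial too.
\<close>

lemma act_generator_polynomial: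
  assumes "\<pi> v = 1"
  shows "\<exists>f. \<forall>l. act E a l v = scl E (\<pi> (act E a l v)) v + \<iota> (at_lam f l)"
proof -
  obtain N c where c: "\<And>l. act E a l v = (\<Sum>n\<le>N. scl E [:l ^ n:] (c n))"
    using act_polynomial [of a v] by (auto simp: polynomial_family_def)
  have "\<forall>n. \<exists>q. c n = scl E (\<pi> (c n)) v + \<iota> q"
    using decompose [OF assms] by blast
  from choice [OF this] obtain q where q: "\<And>n. c n = scl E (\<pi> (c n)) v + \<iota> (q n)" by blast
  define f where "f = (\<Sum>n\<le>N. monom (q n) n)"
  have "act E a l v = scl E (\<pi> (act E a l v)) v + \<iota> (at_lam f l)" for l
  proof -
    have "at_lam f l = (\<Sum>n\<le>N. [:l ^ n:] * q n)"
      by (simp add: f_def at_lam_def poly_sum poly_monom poly_const_pow mult.commute)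
    then have "scl E (\<Sum>n\<le>N. [:l ^ n:] * \<pi> (c n)) v + \<iota> (at_lam f l)
      = (\<Sum>n\<le>N. scl E [:l ^ n:] (scl E (\<pi> (c n)) v + \<iota> (q n)))"
      by (simp only: iota_sum iota_hom scale_sum_left scale_right_distrib scale_scale sum.distrib)
    also have "\<dots> = act E a l v" unfolding c q [symmetric] ..
    finally have e: "act E a l v = scl E (\<Sum>n\<le>N. [:l ^ n:] * \<pi> (c n)) v + \<iota> (at_lam f l)" ..
    then have "\<pi> (act E a l v) = (\<Sum>n\<le>N. [:l ^ n:] * \<pi> (c n))"
      using assms by (simp add: pi_hom)
    then show ?thesis using e by simp
  qed
  then show ?thesis by blast
qed

text \<open>
  By lemma \<open>decompose\<close>, \<open>E\<close> is spanned over \<open>\<complex>[\<partial>]\<close> by \<open>v\<close> and the submodule, so that \<open>f\<close> and \<open>g\<close>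
  determine the action on all of \<open>E\<close>.
\<close>

definition generator :: "'e \<Rightarrow> complex poly poly \<Rightarrow> complex poly poly \<Rightarrow> bool" where
  "generator v f g \<longleftrightarrow> \<pi> v = 1
     \<and> (\<forall>l. act E genL l v = scl E [:\<alpha> + \<Delta> * l, 1:] v + \<iota> (at_lam f l))
     \<and> (\<forall>l. act E genI l v = \<iota> (at_lam g l))"

lemma ex_generator: "\<exists>v f g. generator v f g"
proof -
  obtain v where v: "\<pi> v = 1" using surj_pi by (metis surjD)
  have "\<pi> (act E genL l v) = [:\<alpha> + \<Delta> * l, 1:]" "\<pi> (act E genI l v) = 0" for l
    using Vmod_generators [of \<alpha> \<Delta>] by (simp_all add: pi_hom v)
  then show ?thesis
    using act_generator_polynomial [OF v, of genL] act_generator_polynomial [OF v, of genI] v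
    by (auto simp: generator_def)
qed

lemma act_decomposed:
  assumes "generator v f g"
  shows "act E a l (scl E p v + \<iota> q) = scl E (act (Vmod \<alpha> \<Delta>) a l p) v
    + \<iota> (act (Vmod \<alpha>' \<Delta>') a l q
        + pshift l p * (pneg l (fst a) * at_lam f l + pneg l (snd a) * at_lam g l))"
proof -
  have "act E a l v = scl E (pneg l (fst a) * [:\<alpha> + \<Delta> * l, 1:]) v
    + \<iota> (pneg l (fst a) * at_lam f l + pneg l (snd a) * at_lam g l)"
    using assms unfolding generator_def act_generators [of a l v]
    by (simp only: scale_right_distrib scale_scale iota_hom add.assoc)
  then show ?thesis
    by (simp only: act_add act_scl Vmod_act iota_hom scale_right_distrib scale_scale ac_simps)
qed

text \<open>
  The axioms for \<open>[L\<^sub>\<lambda> L]\<close> and \<open>[L\<^sub>\<lambda> I]\<close> on \<open>v\<close>, compared in the component along the submodule.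
\<close>

lemma generator_cocycle:
  assumes "generator v f g"
  shows "(z + \<alpha> + l + \<Delta> * m) * poly (at_lam f l) z + (z + \<alpha>' + \<Delta>' * l) * poly (at_lam f m) (z + l)
      - (z + \<alpha> + m + \<Delta> * l) * poly (at_lam f m) z - (z + \<alpha>' + \<Delta>' * m) * poly (at_lam f l) (z + m)
      = (l - m) * (poly (at_lam f (l + m)) z + poly (at_lam g (l + m)) z)"
    and "(z + \<alpha>' + \<Delta>' * l) * poly (at_lam g m) (z + l) - (z + \<alpha> + m + \<Delta> * l) * poly (at_lam g m) z
      = - m * poly (at_lam g (l + m)) z"
proof -
  have v: "v = scl E 1 v + \<iota> 0" by simp
  have diff: "(scl E p v + \<iota> q) - (scl E p' v + \<iota> q') = scl E (p - p') v + \<iota> (q - q')" for p q p' q'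
    by (simp add: scale_left_diff_distrib iota_diff)
  have pv: "\<pi> v = 1" using assms by (simp add: generator_def)
  \<comment> \<open>the action in the coordinates \<open>(p, q) \<mapsto> p(\<partial>)v + q(\<partial>)v'\<close>\<close>
  define X where "X a l x = (act (Vmod \<alpha> \<Delta>) a l (fst x), act (Vmod \<alpha>' \<Delta>') a l (snd x)
        + pshift l (fst x) * (pneg l (fst a) * at_lam f l + pneg l (snd a) * at_lam g l))" for a l x
  define T where "T x = scl E (fst x) v + \<iota> (snd x)" for x
  have act_T: "act E a l (T x) = T (X a l x)" for a l x
    unfolding T_def X_def by (simp add: act_decomposed [OF assms])
  have T_diff: "T x - T y = T (x - y)" for x y
    unfolding T_def by (simp only: diff fst_diff snd_diff)
  have T_inj: "snd x = snd y" if "T x = T y" for x y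
    using decompose_unique(2) [OF pv] that unfolding T_def by blast
  have "T (X a l (X b m (1, 0)) - X b m (X a l (1, 0))) = T (X (lca_bracket a l b) (l + m) (1, 0))" for a b l m
    using act_bracket [of a l b m "T (1, 0)"] by (simp only: act_T T_diff)
  from T_inj [OF this] have *: "poly (snd (X a l (X b m (1, 0)) - X b m (X a l (1, 0)))) z
      = poly (snd (X (lca_bracket a l b) (l + m) (1, 0))) z" for a b l m z
    by simp
  show "(z + \<alpha> + l + \<Delta> * m) * poly (at_lam f l) z + (z + \<alpha>' + \<Delta>' * l) * poly (at_lam f m) (z + l)
      - (z + \<alpha> + m + \<Delta> * l) * poly (at_lam f m) z - (z + \<alpha>' + \<Delta>' * m) * poly (at_lam f l) (z + m)
      = (l - m) * (poly (at_lam f (l + m)) z + poly (at_lam g (l + m)) z)"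
    using * [of genL l genL m z] unfolding lca_bracket_generators
    by (simp add: X_def Vmod_def genL_def genI_def lca_scale_def algebra_simps)
  show "(z + \<alpha>' + \<Delta>' * l) * poly (at_lam g m) (z + l) - (z + \<alpha> + m + \<Delta> * l) * poly (at_lam g m) z
      = - m * poly (at_lam g (l + m)) z"
    using * [of genL l genI m z] unfolding lca_bracket_generators
    by (simp add: X_def Vmod_def genL_def genI_def lca_scale_def algebra_simps)
qed

lemma generator_shift:
  assumes "generator v f g"
    and "\<And>l z. poly (at_lam f l) z = (z + \<alpha>' + \<Delta>' * l) * poly \<phi> (z + l) - (z + \<alpha> + \<Delta> * l) * poly \<phi> z
      + poly (at_lam f' l) z"
    and "\<And>l z. poly (at_lam g l) z = poly (at_lam g' l) z"
  shows "generator (v - \<iota> \<phi>) f' g'"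
proof -
  have g: "at_lam g l = at_lam g' l" for l
    using assms(3) by (rule poly_eqI)
  have v: "v - \<iota> \<phi> = scl E 1 v + \<iota> (- \<phi>)" by (simp add: iota_minus)
  have "act (Vmod \<alpha>' \<Delta>') genL l (- \<phi>) + pshift l 1 * (pneg l (fst genL) * at_lam f l + pneg l (snd genL) * at_lam g l)
      = at_lam f' l - [:\<alpha> + \<Delta> * l, 1:] * \<phi>" for l
    by (rule poly_eqI) (simp add: Vmod_def genL_def assms(2) algebra_simps)
  then have "act E genL l (v - \<iota> \<phi>) = scl E [:\<alpha> + \<Delta> * l, 1:] v + \<iota> (at_lam f' l - [:\<alpha> + \<Delta> * l, 1:] * \<phi>)" for l
    unfolding v act_decomposed [OF assms(1)] Vmod_generators by simp
  then have L: "act E genL l (v - \<iota> \<phi>) = scl E [:\<alpha> + \<Delta> * l, 1:] (v - \<iota> \<phi>) + \<iota> (at_lam f' l)" for l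
    by (simp only: iota_diff iota_hom scale_right_diff_distrib) simp
  have I: "act E genI l (v - \<iota> \<phi>) = \<iota> (at_lam g' l)" for l
    unfolding v act_decomposed [OF assms(1)]
    by (simp add: Vmod_def genI_def pneg_def pshift_def pcompose_1 g)
  show ?thesis using assms(1) L I by (simp add: generator_def pi_diff)
qed

lemma generator_equivalent:
  assumes "generator v f g"
  shows "equivalent_ext E \<iota> \<pi> (Emod \<alpha>' \<Delta>' \<alpha> \<Delta> f g) (\<lambda>q. (q, 0)) snd"
proof -
  have pv: "\<pi> v = 1" using assms by (simp add: generator_def)
  define \<psi> where "\<psi> e = (inv \<iota> (e - scl E (\<pi> e) v), \<pi> e)" for e
  have \<psi>: "\<psi> (scl E p v + \<iota> q) = (q, p)" for p q
    using inj_iota pv by (simp add: \<psi>_def pi_hom)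
  have ex: "\<exists>p q. e = scl E p v + \<iota> q" for e
    using decompose [OF pv] by blast
  have add: "\<psi> (e + e') = \<psi> e + \<psi> e'" for e e'
  proof -
    obtain p q p' q' where e: "e = scl E p v + \<iota> q" "e' = scl E p' v + \<iota> q'" using ex by metis
    have "e + e' = scl E (p + p') v + \<iota> (q + q')"
      by (simp add: e scale_left_distrib iota_hom)
    then show ?thesis by (simp only: e \<psi>) simp
  qed
  have scale: "\<psi> (scl E r e) = scl (Emod \<alpha>' \<Delta>' \<alpha> \<Delta> f g) r (\<psi> e)" for r e
  proof -
    obtain p q where e: "e = scl E p v + \<iota> q" using ex by metis
    have "scl E r e = scl E (r * p) v + \<iota> (r * q)"
      by (simp add: e scale_right_distrib iota_hom)
    then show ?thesis by (simp only: e \<psi>) (simp add: Emod_def)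
  qed
  have act: "\<psi> (act E a l e) = act (Emod \<alpha>' \<Delta>' \<alpha> \<Delta> f g) a l (\<psi> e)" for a l e
  proof -
    obtain p q where e: "e = scl E p v + \<iota> q" using ex by metis
    show ?thesis unfolding e act_decomposed [OF assms] \<psi> by (simp add: Emod_def)
  qed
  have "module (scl (Emod \<alpha>' \<Delta>' \<alpha> \<Delta> f g))"
    by unfold_locales (simp_all add: Emod_def algebra_simps)
  then have "cmod_hom E (Emod \<alpha>' \<Delta>' \<alpha> \<Delta> f g) \<psi>"
    unfolding cmod_hom_def module_hom_def module_hom_axioms_def
    using add scale act module_axioms by blast
  moreover have "\<psi> \<circ> \<iota> = (\<lambda>q. (q, 0))"
    using \<psi> [of 0] by (simp add: fun_eq_iff)
  moreover have "snd \<circ> \<psi> = \<pi>" by (simp add: fun_eq_iff \<psi>_def)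
  ultimately show ?thesis unfolding equivalent_ext_def by blast
qed

lemma generator_trivial:
  assumes "generator v 0 0"
  shows "trivial_extension (Vmod \<alpha>' \<Delta>') (Vmod \<alpha> \<Delta>) E \<iota> \<pi>"
proof -
  have "Emod \<alpha>' \<Delta>' \<alpha> \<Delta> 0 0 = cmod_sum (Vmod \<alpha>' \<Delta>') (Vmod \<alpha> \<Delta>)"
    by (simp add: Emod_def cmod_sum_def Vmod_def at_lam_def fun_eq_iff)
  then show ?thesis
    using generator_equivalent [OF assms] ext by (simp add: trivial_extension_def)
qed

end

section \<open>Modules defined by cocycles\<close>

lemma polynomial_family_pair:
  "polynomial_family (\<lambda>p x. (p * fst x, p * snd x)) (\<lambda>l. (at_lam f l, at_lam g l))"
proof -
  define N where "N = max (degree f) (degree g)"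
  have at_lam_sum: "at_lam h l = (\<Sum>n\<le>N. [:l ^ n:] * coeff h n)" if "degree h \<le> N" for h l
  proof -
    have "at_lam h l = (\<Sum>n\<le>degree h. [:l ^ n:] * coeff h n)"
      by (simp add: at_lam_def poly_altdef [of h] poly_const_pow mult.commute)
    also have "\<dots> = (\<Sum>n\<le>N. [:l ^ n:] * coeff h n)"
      using that by (intro sum.mono_neutral_left) (auto simp: coeff_eq_0)
    finally show ?thesis .
  qed
  have "(at_lam f l, at_lam g l) = (\<Sum>n\<le>N. ([:l ^ n:] * coeff f n, [:l ^ n:] * coeff g n))" for l
    by (simp add: sum_prod at_lam_sum N_def)
  then show ?thesis
    unfolding polynomial_family_def by (intro exI [of _ N] exI [of _ "\<lambda>n. (coeff f n, coeff g n)"]) simp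
qed

lemma Emod_act_eval:
  "poly (fst (act (Emod \<alpha>' \<Delta>' \<alpha> \<Delta> f g) a l v)) z
    = poly (fst a) (- l) * poly (fst v) (z + l) * (z + \<alpha>' + \<Delta>' * l)
      + poly (snd v) (z + l) * (poly (fst a) (- l) * poly (at_lam f l) z + poly (snd a) (- l) * poly (at_lam g l) z)"
  "poly (snd (act (Emod \<alpha>' \<Delta>' \<alpha> \<Delta> f g) a l v)) z
    = poly (fst a) (- l) * poly (snd v) (z + l) * (z + \<alpha> + \<Delta> * l)"
  by (simp_all add: Emod_def Vmod_def algebra_simps)

lemma lca_bracket_eval:
  "poly (fst (lca_bracket a l b)) (- (l + m)) = poly (fst a) (- l) * poly (fst b) (- m) * (l - m)"
  "poly (snd (lca_bracket a l b)) (- (l + m)) = poly (fst a) (- l) * poly (fst b) (- m) * (l - m)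
    - poly (fst a) (- l) * poly (snd b) (- m) * m + poly (snd a) (- l) * poly (fst b) (- m) * l"
  by (simp_all add: lca_bracket_def lca_scale_def genL_def genI_def algebra_simps)

text \<open>
  Of the module axioms only the one for the bracket uses the cocycle equations. Its component in the
  submodule is bilinear in the values of \<open>a\<close> and \<open>b\<close>, hence a combination of the defects for \<open>(L,L)\<close>,
  \<open>(L,I)\<close> and \<open>(I,L)\<close>; for \<open>(I,I)\<close> both sides are zero.
\<close>

lemma conformal_module_Emod:
  assumes LL: "\<And>y l m. LL_defect \<Delta>' \<Delta> (eval_at \<alpha> f) (eval_at \<alpha> g) y l m = 0"
    and LI: "\<And>y l m. LI_defect \<Delta>' \<Delta> (eval_at \<alpha> g) y l m = 0"
  shows "conformal_module (Emod \<alpha> \<Delta>' \<alpha> \<Delta> f g)"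
proof -
  let ?M = "Emod \<alpha> \<Delta>' \<alpha> \<Delta> f g"
  have scl: "scl ?M p x = (p * fst x, p * snd x)" for p x
    by (simp add: Emod_def)
  have eqI: "x = y" if "\<And>z. poly (fst x) z = poly (fst y) z" "\<And>z. poly (snd x) z = poly (snd y) z"
    for x y :: "complex poly \<times> complex poly"
    using that by (intro prod_eqI poly_eqI)
  have "module (scl ?M)"
    by unfold_locales (simp_all add: scl algebra_simps)
  have "polynomial_family (scl ?M) (\<lambda>l. act ?M a l v)" for a v
  proof -
    obtain P1 P2 S1 S2 where "\<And>l. pneg l (fst a) = at_lam P1 l" "\<And>l. pneg l (snd a) = at_lam P2 l"
        "\<And>l. pshift l (fst v) = at_lam S1 l" "\<And>l. pshift l (snd v) = at_lam S2 l"
      using pneg_at_lam pshift_at_lam by metis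
    then have "act ?M a l v
        = (at_lam (P1 * S1 * [:[:\<alpha>, 1:], [:\<Delta>':]:] + S2 * (P1 * f + P2 * g)) l,
           at_lam (P1 * S2 * [:[:\<alpha>, 1:], [:\<Delta>:]:]) l)" for l
      by (simp add: Emod_def Vmod_def at_lam_def smult_add_left)
    then show ?thesis
      using polynomial_family_pair by (simp add: scl [abs_def])
  qed
  have "act ?M a l (v + w) = act ?M a l v + act ?M a l w" for a l v w
    by (rule eqI) (simp_all add: Emod_act_eval algebra_simps)
  have "act ?M a l (scl ?M [:c:] v) = scl ?M [:c:] (act ?M a l v)" for a l c v
    by (rule eqI) (simp_all add: Emod_act_eval scl algebra_simps)
  have "act ?M (a + b) l v = act ?M a l v + act ?M b l v" for a b l v
    by (rule eqI) (simp_all add: Emod_act_eval algebra_simps)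
  have "act ?M (lca_scale [:c:] a) l v = scl ?M [:c:] (act ?M a l v)" for c a l v
    by (rule eqI) (simp_all add: Emod_act_eval scl lca_scale_def algebra_simps)
  have "act ?M (lca_scale Dpoly a) l v = scl ?M Dpoly (act ?M a l v) - act ?M a l (scl ?M Dpoly v)" for a l v
    by (rule eqI) (simp_all add: Emod_act_eval scl lca_scale_def algebra_simps)
  have "act ?M (lca_scale Dpoly a) l v = - scl ?M [:l:] (act ?M a l v)" for a l v
    by (rule eqI) (simp_all add: Emod_act_eval scl lca_scale_def algebra_simps)
  have "act ?M a l (act ?M b m v) - act ?M b m (act ?M a l v) = act ?M (lca_bracket a l b) (l + m) v"
    for a b l m v
  proof (rule eqI)
    fix z
    define F where "F l z = poly (at_lam f l) z" for l z
    define G where "G l z = poly (at_lam g l) z" for l z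
    define A1 where "A1 = poly (fst a) (- l)"
    define A2 where "A2 = poly (snd a) (- l)"
    define B1 where "B1 = poly (fst b) (- m)"
    define B2 where "B2 = poly (snd b) (- m)"
    define q where "q = poly (snd v) (z + (l + m))"
    have q: "q = poly (snd v) (z + l + m)" "q = poly (snd v) (z + m + l)" by (simp_all add: q_def ac_simps)
    have p: "poly (fst v) (z + m + l) = poly (fst v) (z + l + m)" by (simp add: ac_simps)
    have FG: "eval_at \<alpha> f (z + \<alpha>) k = F k z" "eval_at \<alpha> g (z + \<alpha>) k = G k z"
      "eval_at \<alpha> f (z + \<alpha> + j) k = F k (z + j)" "eval_at \<alpha> g (z + \<alpha> + j) k = G k (z + j)" for k j
      by (simp_all add: F_def G_def eval_at_def algebra_simps)
    have D: "LL_defect \<Delta>' \<Delta> (eval_at \<alpha> f) (eval_at \<alpha> g) (z + \<alpha>) l m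
        = (z + \<alpha> + l + \<Delta> * m) * F l z + (z + \<alpha> + \<Delta>' * l) * F m (z + l)
          - (z + \<alpha> + m + \<Delta> * l) * F m z - (z + \<alpha> + \<Delta>' * m) * F l (z + m)
          - (l - m) * (F (l + m) z + G (l + m) z)"
      "LI_defect \<Delta>' \<Delta> (eval_at \<alpha> g) (z + \<alpha>) l m
        = (z + \<alpha> + \<Delta>' * l) * G m (z + l) - (z + \<alpha> + m + \<Delta> * l) * G m z + m * G (l + m) z"
      "LI_defect \<Delta>' \<Delta> (eval_at \<alpha> g) (z + \<alpha>) m l
        = (z + \<alpha> + \<Delta>' * m) * G l (z + m) - (z + \<alpha> + l + \<Delta> * m) * G l z + l * G (l + m) z"
      by (simp_all only: LL_defect_def LI_defect_def FG add.commute [of m l])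
    have "poly (fst (act ?M a l (act ?M b m v) - act ?M b m (act ?M a l v))) z
        - poly (fst (act ?M (lca_bracket a l b) (l + m) v)) z
      = q * (A1 * B1 * LL_defect \<Delta>' \<Delta> (eval_at \<alpha> f) (eval_at \<alpha> g) (z + \<alpha>) l m
          + A1 * B2 * LI_defect \<Delta>' \<Delta> (eval_at \<alpha> g) (z + \<alpha>) l m
          - A2 * B1 * LI_defect \<Delta>' \<Delta> (eval_at \<alpha> g) (z + \<alpha>) m l)"
      unfolding D fst_diff poly_diff Emod_act_eval lca_bracket_eval
        F_def [symmetric] G_def [symmetric] A1_def [symmetric] A2_def [symmetric]
        B1_def [symmetric] B2_def [symmetric] q [symmetric] q_def [symmetric] p
      by (simp add: algebra_simps)
    then show "poly (fst (act ?M a l (act ?M b m v) - act ?M b m (act ?M a l v))) z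
        = poly (fst (act ?M (lca_bracket a l b) (l + m) v)) z"
      by (simp add: LL LI)
    show "poly (snd (act ?M a l (act ?M b m v) - act ?M b m (act ?M a l v))) z
        = poly (snd (act ?M (lca_bracket a l b) (l + m) v)) z"
      unfolding snd_diff poly_diff Emod_act_eval lca_bracket_eval by (simp add: algebra_simps)
  qed
  show ?thesis unfolding conformal_module_def by (intro conjI allI; fact)
qed

lemma is_extension_Emod:
  assumes "conformal_module (Emod \<alpha>' \<Delta>' \<alpha> \<Delta> f g)"
  shows "is_extension (Vmod \<alpha>' \<Delta>') (Vmod \<alpha> \<Delta>) (Emod \<alpha>' \<Delta>' \<alpha> \<Delta> f g) (\<lambda>q. (q, 0)) snd"
proof -
  have m: "module (scl (Emod \<alpha>' \<Delta>' \<alpha> \<Delta> f g))" "module (scl (Vmod \<alpha>' \<Delta>'))" "module (scl (Vmod \<alpha> \<Delta>))"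
    using assms conformal_module_Vmod by (simp_all add: conformal_module_def)
  have "cmod_hom (Vmod \<alpha>' \<Delta>') (Emod \<alpha>' \<Delta>' \<alpha> \<Delta> f g) (\<lambda>q. (q, 0))"
    unfolding cmod_hom_def module_hom_def module_hom_axioms_def
    using m by (auto simp: Emod_def Vmod_def pshift_def)
  moreover have "cmod_hom (Emod \<alpha>' \<Delta>' \<alpha> \<Delta> f g) (Vmod \<alpha> \<Delta>) snd"
    unfolding cmod_hom_def module_hom_def module_hom_axioms_def
    using m by (auto simp: Emod_def Vmod_def)
  ultimately show ?thesis
    using assms conformal_module_Vmod
    by (auto simp: is_extension_def inj_on_def surj_def)
qed

text \<open>
  An equivalence with the direct sum sends the generator \<open>(0, 1)\<close> to \<open>(\<phi>, 1)\<close> for some \<open>\<phi>\<close>.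
\<close>

lemma trivial_Emod_coboundary:
  assumes "trivial_extension (Vmod \<alpha> \<Delta>') (Vmod \<alpha> \<Delta>) (Emod \<alpha> \<Delta>' \<alpha> \<Delta> f g) (\<lambda>q. (q, 0)) snd"
  shows "\<exists>\<phi>. (\<forall>y l. eval_at \<alpha> f y l = coboundary \<Delta>' \<Delta> (poly \<phi>) y l) \<and> (\<forall>y l. eval_at \<alpha> g y l = 0)"
proof -
  let ?E = "Emod \<alpha> \<Delta>' \<alpha> \<Delta> f g" and ?S = "cmod_sum (Vmod \<alpha> \<Delta>') (Vmod \<alpha> \<Delta>)"
  obtain \<psi> where hform: "cmod_hom ?E ?S \<psi>" and \<iota>: "\<psi> \<circ> (\<lambda>q. (q, 0)) = (\<lambda>q. (q, 0))" and \<pi>: "snd \<circ> \<psi> = snd"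
    using assms by (auto simp: trivial_extension_def equivalent_ext_def)
  have add: "\<psi> (x + y) = \<psi> x + \<psi> y" and scale: "\<psi> (scl ?E r x) = scl ?S r (\<psi> x)"
    and act: "\<psi> (act ?E a l x) = act ?S a l (\<psi> x)" for x y r a l
    using hform by (auto simp: cmod_hom_def module_hom_def module_hom_axioms_def simp del: split_paired_All)
  define \<phi> where "\<phi> = fst (\<psi> (0, 1))"
  have 1: "\<psi> (0, 1) = (\<phi>, 1)"
    using fun_cong [OF \<pi>, of "(0, 1)"] by (simp add: \<phi>_def prod_eq_iff)
  have \<psi>: "\<psi> (q, p) = (q + p * \<phi>, p)" for q p
  proof -
    have "(q, p) = (q, 0) + scl ?E p (0, 1)" by (simp add: Emod_def)
    then have "\<psi> (q, p) = \<psi> (q, 0) + scl ?S p (\<psi> (0, 1))" by (simp only: add scale)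
    then show ?thesis using fun_cong [OF \<iota>, of q] by (simp add: 1 cmod_sum_def Vmod_def)
  qed
  have p1: "pshift l 1 = 1" for l by (simp add: pshift_def pcompose_1)
  have f: "at_lam f l = pshift l \<phi> * [:\<alpha> + \<Delta>' * l, 1:] - [:\<alpha> + \<Delta> * l, 1:] * \<phi>" for l
    using act [of genL l "(0, 1)"] unfolding Emod_generators \<psi>
    by (simp add: cmod_sum_def Vmod_def genL_def pneg_def p1 algebra_simps)
  have g: "at_lam g l = 0" for l
    using act [of genI l "(0, 1)"] unfolding Emod_generators \<psi>
    by (simp add: cmod_sum_def Vmod_def genI_def pneg_def)
  have "eval_at \<alpha> f y l = coboundary \<Delta>' \<Delta> (poly (pcompose \<phi> [:- \<alpha>, 1:])) y l" "eval_at \<alpha> g y l = 0" for y l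
    unfolding eval_at_def f g coboundary_def by (simp_all add: poly_pcompose algebra_simps)
  then show ?thesis by blast
qed

lemma listed_nontrivial:
  assumes "listed \<alpha> \<Delta>' \<Delta> f g" "\<Delta>' \<noteq> 0"
  shows "nontrivial_extension (Vmod \<alpha> \<Delta>') (Vmod \<alpha> \<Delta>) (Emod \<alpha> \<Delta>' \<alpha> \<Delta> f g) (\<lambda>q. (q, 0)) snd"
proof -
  note n = normal_cocycle_of_listed [OF assms]
  have "conformal_module (Emod \<alpha> \<Delta>' \<alpha> \<Delta> f g)"
    by (rule conformal_module_Emod) (rule normal_cocycle_defects [OF n])+
  then have "is_extension (Vmod \<alpha> \<Delta>') (Vmod \<alpha> \<Delta>) (Emod \<alpha> \<Delta>' \<alpha> \<Delta> f g) (\<lambda>q. (q, 0)) snd"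
    by (rule is_extension_Emod)
  moreover have "\<not> trivial_extension (Vmod \<alpha> \<Delta>') (Vmod \<alpha> \<Delta>) (Emod \<alpha> \<Delta>' \<alpha> \<Delta> f g) (\<lambda>q. (q, 0)) snd"
    using trivial_Emod_coboundary normal_cocycle_not_coboundary [OF n assms(2)] by blast
  ultimately show ?thesis by (simp add: nontrivial_extension_def)
qed

lemma listed_difference:
  assumes "listed \<alpha> \<Delta>' \<Delta> f g"
  shows "\<Delta> - \<Delta>' \<in> {0, 1, 2, 3, 4, 5, 6}"
  using assms
proof cases
  case vii
  then have "\<Delta> - \<Delta>' = 6" by auto
  then show ?thesis by simp
qed auto

section \<open>Classification of extensions\<close>

context extension
begin

text \<open>
  At \<open>\<lambda> = 0\<close> the second cocycle equation becomes \<open>(\<alpha>' - \<alpha>) g = 0\<close>. Then the first one at \<open>\<mu> = 0\<close>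
  exhibits \<open>(\<alpha>' - \<alpha>) f\<close> as the coboundary of \<open>f(\<partial>,0)\<close>.
\<close>

lemma trivial_if_distinct:
  assumes "\<alpha> \<noteq> \<alpha>'"
  shows "trivial_extension (Vmod \<alpha>' \<Delta>') (Vmod \<alpha> \<Delta>) E \<iota> \<pi>"
proof -
  obtain v f g where gen: "generator v f g" using ex_generator by blast
  have g: "poly (at_lam g l) z = 0" for l z
  proof -
    have "(\<alpha>' - \<alpha>) * poly (at_lam g l) z = 0"
      using generator_cocycle(2) [OF gen, of z 0 l] by (simp add: algebra_simps)
    then show ?thesis using assms by simp
  qed
  define \<phi> where "\<phi> = smult (1 / (\<alpha>' - \<alpha>)) (at_lam f 0)"
  have "poly (at_lam f l) z = (z + \<alpha>' + \<Delta>' * l) * poly \<phi> (z + l) - (z + \<alpha> + \<Delta> * l) * poly \<phi> z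
      + poly (at_lam 0 l) z" for l z
  proof -
    have "(\<alpha>' - \<alpha>) * poly (at_lam f l) z
      = (z + \<alpha>' + \<Delta>' * l) * poly (at_lam f 0) (z + l) - (z + \<alpha> + \<Delta> * l) * poly (at_lam f 0) z"
      using generator_cocycle(1) [OF gen, of z l 0] by (simp add: g algebra_simps)
    then have "poly (at_lam f l) z
      = ((z + \<alpha>' + \<Delta>' * l) * poly (at_lam f 0) (z + l) - (z + \<alpha> + \<Delta> * l) * poly (at_lam f 0) z) / (\<alpha>' - \<alpha>)"
      using assms by (metis nonzero_mult_div_cancel_left right_minus_eq)
    then show ?thesis by (simp add: \<phi>_def at_lam_simps diff_divide_distrib)
  qed
  from generator_shift [OF gen this] have "generator (v - \<iota> \<phi>) 0 0"
    by (simp add: g at_lam_simps)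
  then show ?thesis by (rule generator_trivial)
qed

text \<open>
  Changing the generator by the polynomial \<open>\<phi>\<close> of \<open>cocycle_classification\<close> brings \<open>(f, g)\<close> into normal
  form.
\<close>

lemma trivial_or_listed:
  assumes "\<alpha> = \<alpha>'" "\<Delta>' \<noteq> 0"
  shows "trivial_extension (Vmod \<alpha>' \<Delta>') (Vmod \<alpha> \<Delta>) E \<iota> \<pi>
    \<or> (\<exists>f g. listed \<alpha> \<Delta>' \<Delta> f g \<and> equivalent_ext E \<iota> \<pi> (Emod \<alpha>' \<Delta>' \<alpha> \<Delta> f g) (\<lambda>q. (q, 0)) snd)"
proof -
  obtain v f g where gen: "generator v f g" using ex_generator by blast
  have "LL_defect \<Delta>' \<Delta> (eval_at \<alpha> f) (eval_at \<alpha> g) y l m = 0" for y l m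
    using generator_cocycle(1) [OF gen, of "y - \<alpha>" l m] assms(1)
    by (simp add: LL_defect_def eval_at_def algebra_simps)
  moreover have "LI_defect \<Delta>' \<Delta> (eval_at \<alpha> g) y l m = 0" for y l m
    using generator_cocycle(2) [OF gen, of "y - \<alpha>" l m] assms(1)
    by (simp add: LI_defect_def eval_at_def algebra_simps)
  ultimately obtain \<phi> P where f: "\<forall>y l. eval_at \<alpha> f y l = coboundary \<Delta>' \<Delta> (poly \<phi>) y l + P y l"
    and P: "(\<forall>y l. P y l = 0 \<and> eval_at \<alpha> g y l = 0) \<or> normal_cocycle \<Delta>' \<Delta> P (eval_at \<alpha> g)"
    using cocycle_classification [OF assms(2), of \<Delta> \<alpha> f g] by metis
  have shift: "\<exists>v. generator v f' g'" if "P = eval_at \<alpha> f'" "eval_at \<alpha> g = eval_at \<alpha> g'" for f' g'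
  proof -
    have f': "poly (at_lam f l) z = (z + \<alpha>' + \<Delta>' * l) * poly (pcompose \<phi> [:\<alpha>, 1:]) (z + l)
        - (z + \<alpha> + \<Delta> * l) * poly (pcompose \<phi> [:\<alpha>, 1:]) z + poly (at_lam f' l) z" for l z
      using f [rule_format, of "z + \<alpha>" l] assms(1) that(1)
      by (simp add: eval_at_def coboundary_def poly_pcompose algebra_simps)
    have g': "poly (at_lam g l) z = poly (at_lam g' l) z" for l z
      using fun_cong [OF fun_cong [OF that(2)], of "z + \<alpha>" l] by (simp add: eval_at_def)
    from generator_shift [OF gen f' g'] show ?thesis by blast
  qed
  from P show ?thesis
  proof
    assume "\<forall>y l. P y l = 0 \<and> eval_at \<alpha> g y l = 0"
    then obtain v where "generator v 0 0"
      using shift [of 0 0] by (auto simp: fun_eq_iff eval_at_simps)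
    then show ?thesis using generator_trivial by blast
  next
    assume "normal_cocycle \<Delta>' \<Delta> P (eval_at \<alpha> g)"
    then obtain f' g' where "listed \<alpha> \<Delta>' \<Delta> f' g'" "P = eval_at \<alpha> f'" "eval_at \<alpha> g = eval_at \<alpha> g'"
      using listed_of_normal_cocycle assms(2) by blast
    then show ?thesis using shift generator_equivalent by blast
  qed
qed

end

theorem theorem4p8:
  fixes \<alpha> \<alpha>' \<Delta> \<Delta>' :: complex
  assumes "\<Delta> \<noteq> 0" and "\<Delta>' \<noteq> 0"
  shows
    "(\<forall>(E :: 'e::ab_group_add cmod) \<iota> \<pi>.
        nontrivial_extension (Vmod \<alpha>' \<Delta>') (Vmod \<alpha> \<Delta>) E \<iota> \<pi> \<longrightarrow>
          \<alpha> = \<alpha>' \<and> \<Delta> - \<Delta>' \<in> {0, 1, 2, 3, 4, 5, 6}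
          \<and> (\<exists>f g. listed \<alpha> \<Delta>' \<Delta> f g
                 \<and> equivalent_ext E \<iota> \<pi> (Emod \<alpha>' \<Delta>' \<alpha> \<Delta> f g) (\<lambda>q. (q, 0)) snd))
   \<and> (\<alpha> = \<alpha>' \<longrightarrow>
        (\<forall>f g. listed \<alpha> \<Delta>' \<Delta> f g \<longrightarrow>
           nontrivial_extension (Vmod \<alpha>' \<Delta>') (Vmod \<alpha> \<Delta>)
             (Emod \<alpha>' \<Delta>' \<alpha> \<Delta> f g) (\<lambda>q. (q, 0)) snd))"
proof (intro conjI allI impI)
  fix E :: "'e cmod" and \<iota> \<pi>
  assume n: "nontrivial_extension (Vmod \<alpha>' \<Delta>') (Vmod \<alpha> \<Delta>) E \<iota> \<pi>"
  then interpret extension \<alpha>' \<Delta>' \<alpha> \<Delta> E \<iota> \<pi>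
    by unfold_locales (simp add: nontrivial_extension_def)
  have nt: "\<not> trivial_extension (Vmod \<alpha>' \<Delta>') (Vmod \<alpha> \<Delta>) E \<iota> \<pi>"
    using n by (simp add: nontrivial_extension_def)
  show "\<alpha> = \<alpha>'" using nt trivial_if_distinct by blast
  then show ex: "\<exists>f g. listed \<alpha> \<Delta>' \<Delta> f g \<and> equivalent_ext E \<iota> \<pi> (Emod \<alpha>' \<Delta>' \<alpha> \<Delta> f g) (\<lambda>q. (q, 0)) snd"
    using nt trivial_or_listed assms(2) by blast
  then show "\<Delta> - \<Delta>' \<in> {0, 1, 2, 3, 4, 5, 6}" using listed_difference by blast
next
  fix f g
  assume "\<alpha> = \<alpha>'" "listed \<alpha> \<Delta>' \<Delta> f g"
  then show "nontrivial_extension (Vmod \<alpha>' \<Delta>') (Vmod \<alpha> \<Delta>) (Emod \<alpha>' \<Delta>' \<alpha> \<Delta> f g) (\<lambda>q. (q, 0)) snd"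
    using listed_nontrivial assms(2) by simp
qed

end
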